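(* Let $t\in T$, let $\mathfrak s=\Phi(t)$ be the associated proper cluster, with diameter $\mu=\mu(\mathfrak s)$, and let $r\in\mathfrak s$. Let $\tilde{\mathfrak s}_1,\dots,\tilde{\mathfrak s}_N$ be the children of $\mathfrak s$ and $a_i=|\tilde{\mathfrak s}_i|$. Let $e_t$ be the valuation of the content of the polynomial $f(\pi^{\mu}x_t+r)$ in the variable $x_t$, let $f_t(x_t)=\pi^{-e_t}f(\pi^{\mu}x_t+r)\in\mathcal O[x_t]$, and let $\overline{\mathcal Y}_t$ be the curve over the residue field $k$ with equation $$\overline{\mathcal Y}_t:\ y_t^n=\overline{f_t}(x_t),$$ where $\overline{f_t}$ is the reduction of $f_t$. Let $$c_t=\prod_{\beta\in\mathcal R\setminus\mathfrak s}\frac{r-\beta}{\pi^{v(r-\beta)}}\in\mathcal O^\times,$$ and let $d=\gcd(n,a_1,\dots,a_N)$. Then the curve $\overline{\mathcal Y}_t$ has $d$ irreducible components, defined over (the residue field of) the extension $K(c_t^{1/d})$. In particular the same holds for the normalization $\overline{Y_t}$ of $\overline{\mathcal Y}_t$.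
   Context: $\mathcal O$ is a complete discrete valuation ring with uniformizer $\pi$, fraction field $K$, residue field $k$ of characteristic $p$, and valuation $v$ with $v(\pi)=1$, extended to an algebraic closure $\overline K$. $n\ge 2$ is an integer with $p\nmid n$, and $K$ contains a primitive $n$-th root of unity. $f(x)\in\mathcal O[x]$ is monic with nonzero discriminant, its set of roots $\mathcal R$ is contained in $K$, and the curve $\mathcal C: y^n=f(x)$ has positive genus. Set $S=\mathcal R\cup\{\infty\}$ if $n\nmid\deg f$, and $S=\mathcal R$ otherwise. $T$ is the set of triples of distinct elements of $S$. With the convention $v(\infty)=-\infty$ (and a difference of a finite element and $\infty$ being $\infty$), an ordered triple is $(a,b,c)\in T$ with $v(a-c)=v(b-c)\le v(a-b)$; every triple becomes ordered after a permutation of its entries. For $z\in\overline K$, $d\in\mathbb Q$ let $D(z,d)=\{x\in\overline K: v(x-z)\ge d\}$. A cluster is a non-empty subset of $\mathcal R$ of the form $D(z,d)\cap\mathcal R$; it is proper if it has more than one element. The diameter of a proper cluster is $\mu(\mathfrak s)=\min\{v(z-t): z,t\in\mathfrak s\}$. A child of a cluster $\mathfrak s$ is a maximal cluster (possibly a singleton) strictly contained in $\mathfrak s$. For an ordered triple, $\Phi((a,b,c))=D(a,v(a-b))\cap\mathcal R$, and $\Phi$ of an arbitrary triple is $\Phi$ of an ordered permutation of it (this is well defined). Irreducible components are understood geometrically, i.e. over an algebraic closure of $k$. The content of a polynomial over $K$ has valuation equal to the minimum of the valuations of its coefficients. Since $p\nmid d$ and $c_t$ is a unit, $K(c_t^{1/d})/K$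 is unramified, with residue field $k(\overline{c_t}^{1/d})$. *)

theory Defs
  imports
    "HOL-Algebra.Algebraic_Closure_Type"
    "HOL-Algebra.Generated_Fields"
    "HOL-Library.Extended_Real"
    "HOL-Library.Multiset"
    "Subresultants.Resultant_Prelim"
begin

section \<open>Complete discrete valuation rings\<close>

text \<open>
  The fraction field of the discrete valuation ring is a type, the ring itself is
  \<open>{x. 0 \<le> v x}\<close>. Valuations are written additively and take the value \<open>\<infinity>\<close> exactly at 0.
\<close>

locale valued_field =
  fixes v :: "'a::field \<Rightarrow> ereal"
  assumes val_eq_infty_iff: "v x = \<infinity> \<longleftrightarrow> x = 0"
    and val_neq_minf: "v x \<noteq> -\<infinity>"
    and val_mult: "v (x * y) = v x + v y"
    and val_add: "min (v x) (v y) \<le> v (x + y)"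

locale complete_discretely_valued_field = valued_field v
  for v :: "'a::field \<Rightarrow> ereal" +
  fixes \<pi> :: 'a
  assumes val_uniformizer: "v \<pi> = 1"
    and val_int: "x \<noteq> 0 \<Longrightarrow> \<exists>m::int. v x = ereal (of_int m)"
    and complete:
      "(\<forall>B::real. \<exists>N. \<forall>i\<ge>N. \<forall>j\<ge>N. ereal B \<le> v (u i - u j)) \<Longrightarrow>
        \<exists>L. \<forall>B::real. \<exists>N::nat. \<forall>i\<ge>N. ereal B \<le> v (u i - L)"

text \<open>
  A residue field is given by a surjective homomorphism from the valuation ring onto a field
  whose kernel is the maximal ideal; its values outside the valuation ring are irrelevant.
\<close>

locale residue_map = valued_field v
  for v :: "'a::field \<Rightarrow> ereal" +
  fixes \<rho> :: "'a \<Rightarrow> 'b::field"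
  assumes red_one: "\<rho> 1 = 1"
    and red_add: "0 \<le> v x \<Longrightarrow> 0 \<le> v y \<Longrightarrow> \<rho> (x + y) = \<rho> x + \<rho> y"
    and red_mult: "0 \<le> v x \<Longrightarrow> 0 \<le> v y \<Longrightarrow> \<rho> (x * y) = \<rho> x * \<rho> y"
    and red_eq_0_iff: "0 \<le> v x \<Longrightarrow> \<rho> x = 0 \<longleftrightarrow> 0 < v x"
    and red_surj: "\<rho> ` {x. 0 \<le> v x} = UNIV"

text \<open>The integer exponent belonging to a valuation that is known to be a finite integer.\<close>

definition int_val :: "ereal \<Rightarrow> int" where
  "int_val a = \<lfloor>real_of_ereal a\<rfloor>"

definition adjoin :: "'a::field set \<Rightarrow> 'a \<Rightarrow> 'a set" where
  "adjoin F a = generate_field ring_of_type_algebra (insert a F)"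

text \<open>The residue field of a subfield \<open>F\<close>, as a subfield of the residue field of the whole field.\<close>

definition residue_subfield ::
    "('a::field \<Rightarrow> ereal) \<Rightarrow> ('a \<Rightarrow> 'b::field) \<Rightarrow> 'a set \<Rightarrow> 'b set" where
  "residue_subfield v \<rho> F = \<rho> ` {x \<in> F. 0 \<le> v x}"


section \<open>Polynomials\<close>

definition root_set :: "'a::field poly \<Rightarrow> 'a set" where
  "root_set f = {x. poly f x = 0}"

text \<open>
  \<^const>\<open>resultant\<close> uses the actual degree of the derivative, which may be smaller than
  \<open>degree f - 1\<close> in positive characteristic. This changes the Sylvester determinant only by a
  power of \<open>lead_coeff f\<close> and a sign, hence not its vanishing.
\<close>

definition discriminant :: "'a::field poly \<Rightarrow> 'a" where
  "discriminant f =
     (-1) ^ (Polynomial.degree f * (Polynomial.degree f - 1) div 2)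
       * resultant f (pderiv f) / Polynomial.lead_coeff f"

definition content_val :: "('a::field \<Rightarrow> ereal) \<Rightarrow> 'a poly \<Rightarrow> ereal" where
  "content_val v g = Min ((\<lambda>i. v (Polynomial.coeff g i)) ` {..Polynomial.degree g})"


section \<open>The genus\<close>

text \<open>
  Let \<open>F\<close> be an algebraic function field of one variable over the algebraically closed field of
  constants \<open>range \<kappa>\<close>. Its places are identified with the normalized discrete valuations on \<open>F\<close>
  that are trivial on the constants; such a valuation is represented by a function that is 0
  outside of \<open>F - {0}\<close>. Every place has degree 1. The genus is defined as in Riemann's theorem,
  as the maximum of \<open>deg D - l(D) + 1\<close> over all divisors \<open>D\<close>.
\<close>

definition places :: "('c::field \<Rightarrow> 'f::field) \<Rightarrow> 'f set \<Rightarrow> ('f \<Rightarrow> int) set" where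
  "places \<kappa> F = {w.
     (\<forall>h. h \<notin> F - {0} \<longrightarrow> w h = 0) \<and>
     (\<forall>g\<in>F - {0}. \<forall>h\<in>F - {0}. w (g * h) = w g + w h) \<and>
     (\<forall>g\<in>F - {0}. \<forall>h\<in>F - {0}. g + h \<noteq> 0 \<longrightarrow> min (w g) (w h) \<le> w (g + h)) \<and>
     (\<forall>c. w (\<kappa> c) = 0) \<and>
     (\<exists>h\<in>F. w h = 1)}"

definition divisors ::
    "('c::field \<Rightarrow> 'f::field) \<Rightarrow> 'f set \<Rightarrow> (('f \<Rightarrow> int) \<Rightarrow> int) set" where
  "divisors \<kappa> F = {D. finite {w. D w \<noteq> 0} \<and> {w. D w \<noteq> 0} \<subseteq> places \<kappa> F}"

definition divisor_degree :: "(('f \<Rightarrow> int) \<Rightarrow> int) \<Rightarrow> int" where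
  "divisor_degree D = (\<Sum>w\<in>{w. D w \<noteq> 0}. D w)"

definition riemann_roch_space ::
    "('c::field \<Rightarrow> 'f::field) \<Rightarrow> 'f set \<Rightarrow> (('f \<Rightarrow> int) \<Rightarrow> int) \<Rightarrow> 'f set" where
  "riemann_roch_space \<kappa> F D = {h \<in> F. h = 0 \<or> (\<forall>w\<in>places \<kappa> F. 0 \<le> w h + D w)}"

definition riemann_roch_dim ::
    "('c::field \<Rightarrow> 'f::field) \<Rightarrow> 'f set \<Rightarrow> (('f \<Rightarrow> int) \<Rightarrow> int) \<Rightarrow> nat" where
  "riemann_roch_dim \<kappa> F D =
     vector_space.dim (\<lambda>c h. \<kappa> c * h) (riemann_roch_space \<kappa> F D)"

definition function_field_genus :: "('c::field \<Rightarrow> 'f::field) \<Rightarrow> 'f set \<Rightarrow> int" where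
  "function_field_genus \<kappa> F =
     Sup ((\<lambda>D. divisor_degree D - int (riemann_roch_dim \<kappa> F D) + 1) ` divisors \<kappa> F)"

text \<open>
  The curve \<open>y\<^sup>n = f(x)\<close> over the algebraic closure \<open>C\<close> of the ground field: its function field
  is realized inside an algebraic closure of \<open>C(x)\<close>, as the field generated over \<open>C(x)\<close> by an
  \<open>n\<close>-th root of \<open>f\<close>. For \<open>f\<close> nonconstant with nonzero discriminant, \<open>y\<^sup>n - f(x)\<close> is irreducible
  over \<open>C(x)\<close>, so that the choice of the root is immaterial.
\<close>

definition embed_poly :: "'c::field poly \<Rightarrow> 'c poly fract alg_closure" where
  "embed_poly q = to_ac (to_fract q)"

definition superelliptic_function_field ::
    "nat \<Rightarrow> 'c::field poly \<Rightarrow> 'c poly fract alg_closure set" where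
  "superelliptic_function_field n g =
     generate_field ring_of_type_algebra
       (insert (SOME y. y ^ n = embed_poly g) (range embed_poly))"

definition superelliptic_genus :: "nat \<Rightarrow> 'a::field poly \<Rightarrow> int" where
  "superelliptic_genus n f =
     function_field_genus (\<lambda>c. embed_poly [:c:])
       (superelliptic_function_field n (map_poly to_ac f))"


section \<open>Clusters and triples\<close>

datatype 'a proj_point = Finite 'a | Infinity

fun val_diff :: "('a::field \<Rightarrow> ereal) \<Rightarrow> 'a proj_point \<Rightarrow> 'a proj_point \<Rightarrow> ereal" where
  "val_diff v (Finite a) (Finite b) = v (a - b)"
| "val_diff v _ _ = -\<infinity>"

definition branch_points :: "nat \<Rightarrow> 'a::field poly \<Rightarrow> 'a proj_point set" where
  "branch_points n f =
     Finite ` root_set f \<union> (if n dvd Polynomial.degree f then {} else {Infinity})"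

definition triples :: "'p set \<Rightarrow> ('p \<times> 'p \<times> 'p) set" where
  "triples S = {(a, b, c). a \<in> S \<and> b \<in> S \<and> c \<in> S \<and> a \<noteq> b \<and> a \<noteq> c \<and> b \<noteq> c}"

fun ordered_triple ::
    "('a::field \<Rightarrow> ereal) \<Rightarrow> 'a proj_point \<times> 'a proj_point \<times> 'a proj_point \<Rightarrow> bool" where
  "ordered_triple v (a, b, c) \<longleftrightarrow>
     val_diff v a c = val_diff v b c \<and> val_diff v b c \<le> val_diff v a b"

fun permuted_triple :: "'p \<times> 'p \<times> 'p \<Rightarrow> 'p \<times> 'p \<times> 'p \<Rightarrow> bool" where
  "permuted_triple (a, b, c) (a', b', c') \<longleftrightarrow> {#a, b, c#} = {#a', b', c'#}"

definition disc :: "('a::field \<Rightarrow> ereal) \<Rightarrow> 'a \<Rightarrow> ereal \<Rightarrow> 'a set" where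
  "disc v z d = {x. d \<le> v (x - z)}"

text \<open>
  In the following, \<open>vb\<close> is a valuation on the algebraic closure, and \<open>R\<close> is a set of elements of
  the ground field. The first entry of an ordered triple of distinct points is always finite, so
  that the second equation is irrelevant.
\<close>

fun Phi_ordered ::
    "('a::field alg_closure \<Rightarrow> ereal) \<Rightarrow> 'a set \<Rightarrow>
      'a proj_point \<times> 'a proj_point \<times> 'a proj_point \<Rightarrow> 'a set" where
  "Phi_ordered vb R (Finite a, b, c) =
     {x \<in> R. to_ac x \<in> disc vb (to_ac a) (val_diff (vb \<circ> to_ac) (Finite a) b)}"
| "Phi_ordered vb R (Infinity, b, c) = {}"

definition Phi ::
    "('a::field alg_closure \<Rightarrow> ereal) \<Rightarrow> 'a set \<Rightarrow>
      'a proj_point \<times> 'a proj_point \<times> 'a proj_point \<Rightarrow> 'a set" where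
  "Phi vb R t =
     Phi_ordered vb R (SOME t'. permuted_triple t t' \<and> ordered_triple (vb \<circ> to_ac) t')"

definition clusters :: "('a::field alg_closure \<Rightarrow> ereal) \<Rightarrow> 'a set \<Rightarrow> 'a set set" where
  "clusters vb R =
     {s. s \<noteq> {} \<and> (\<exists>z (d::rat). s = {x \<in> R. to_ac x \<in> disc vb z (ereal (of_rat d))})}"

definition children ::
    "('a::field alg_closure \<Rightarrow> ereal) \<Rightarrow> 'a set \<Rightarrow> 'a set \<Rightarrow> 'a set set" where
  "children vb R s =
     {u \<in> clusters vb R. u \<subset> s \<and> \<not> (\<exists>u'\<in>clusters vb R. u \<subset> u' \<and> u' \<subset> s)}"

definition diameter :: "('a::field \<Rightarrow> ereal) \<Rightarrow> 'a set \<Rightarrow> ereal" where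
  "diameter v s = Min ((\<lambda>(x, y). v (x - y)) ` (s \<times> s))"


section \<open>Irreducible components of affine schemes\<close>

definition spec :: "('r, 'm) ring_scheme \<Rightarrow> 'r set set" where
  "spec R = {P. primeideal P R}"

definition zariski_closed :: "('r, 'm) ring_scheme \<Rightarrow> 'r set set \<Rightarrow> bool" where
  "zariski_closed R Z \<longleftrightarrow> (\<exists>I. ideal I R \<and> Z = {P \<in> spec R. I \<subseteq> P})"

definition irreducible_subset :: "('r, 'm) ring_scheme \<Rightarrow> 'r set set \<Rightarrow> bool" where
  "irreducible_subset R Z \<longleftrightarrow> Z \<noteq> {} \<and> Z \<subseteq> spec R \<and>
     (\<forall>Z1 Z2. zariski_closed R Z1 \<and> zariski_closed R Z2 \<and> Z \<subseteq> Z1 \<union> Z2 \<longrightarrow> Z \<subseteq> Z1 \<or> Z \<subseteq> Z2)"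

definition irreducible_components :: "('r, 'm) ring_scheme \<Rightarrow> 'r set set set" where
  "irreducible_components R =
     {Z. irreducible_subset R Z \<and> (\<forall>Z'. irreducible_subset R Z' \<and> Z \<subseteq> Z' \<longrightarrow> Z' = Z)}"

text \<open>
  An affine scheme over a field \<open>k\<close> is given by a ring \<open>Q\<close>, a homomorphism \<open>\<kappa>\<close> from an algebraic
  closure of \<open>k\<close> to \<open>Q\<close>, and a \<open>k\<close>-subalgebra \<open>B\<close> of \<open>Q\<close>, its coordinate ring. In the cases
  considered below, \<open>B\<close> is linearly disjoint from the algebraic closure of \<open>k\<close>, so that the base
  change of \<open>B\<close> to a field \<open>M\<close> between \<open>k\<close> and its algebraic closure (the tensor product of \<open>B\<close>
  and \<open>M\<close>) is the subring of \<open>Q\<close> generated by \<open>B\<close> and \<open>M\<close>.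
\<close>

definition base_change ::
    "('r, 'm) ring_scheme \<Rightarrow> ('c \<Rightarrow> 'r) \<Rightarrow> 'r set \<Rightarrow> 'c set \<Rightarrow> 'r set" where
  "base_change Q \<kappa> B M = generate_ring Q (\<kappa> ` M \<union> B)"

definition geometric_ring ::
    "('r, 'm) ring_scheme \<Rightarrow> ('c \<Rightarrow> 'r) \<Rightarrow> 'r set \<Rightarrow> ('r, 'm) ring_scheme" where
  "geometric_ring Q \<kappa> B = Q\<lparr>carrier := base_change Q \<kappa> B UNIV\<rparr>"

text \<open>
  A closed subset \<open>Z\<close> of the geometric scheme is defined over \<open>M\<close> if its vanishing ideal, the
  intersection of the primes in \<open>Z\<close>, is generated by elements of the coordinate ring over \<open>M\<close>.
\<close>

definition defined_over ::
    "('r, 'm) ring_scheme \<Rightarrow> ('c \<Rightarrow> 'r) \<Rightarrow> 'r set \<Rightarrow> 'c set \<Rightarrow> 'r set set \<Rightarrow> bool" where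
  "defined_over Q \<kappa> B M Z \<longleftrightarrow>
     \<Inter>Z = genideal (geometric_ring Q \<kappa> B) (\<Inter>Z \<inter> base_change Q \<kappa> B M)"

definition has_components_over ::
    "('r, 'm) ring_scheme \<Rightarrow> ('c \<Rightarrow> 'r) \<Rightarrow> 'r set \<Rightarrow> nat \<Rightarrow> 'c set \<Rightarrow> bool" where
  "has_components_over Q \<kappa> B N M \<longleftrightarrow>
     card (irreducible_components (geometric_ring Q \<kappa> B)) = N \<and>
     (\<forall>Z\<in>irreducible_components (geometric_ring Q \<kappa> B). defined_over Q \<kappa> B M Z)"


section \<open>Normalization\<close>

definition regular_elements :: "('r, 'm) ring_scheme \<Rightarrow> 'r set" where
  "regular_elements R =
     {s \<in> carrier R. \<forall>a\<in>carrier R. s \<otimes>\<^bsub>R\<^esub> a = \<zero>\<^bsub>R\<^esub> \<longrightarrow> a = \<zero>\<^bsub>R\<^esub>}"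

definition fraction :: "('r, 'm) ring_scheme \<Rightarrow> 'r \<Rightarrow> 'r \<Rightarrow> ('r \<times> 'r) set" where
  "fraction R a s = {(b, t). b \<in> carrier R \<and> t \<in> regular_elements R \<and> a \<otimes>\<^bsub>R\<^esub> t = b \<otimes>\<^bsub>R\<^esub> s}"

definition total_fractions :: "('r, 'm) ring_scheme \<Rightarrow> ('r \<times> 'r) set ring" where
  "total_fractions R =
     \<lparr>carrier = {fraction R a s | a s. a \<in> carrier R \<and> s \<in> regular_elements R},
      monoid.mult = (\<lambda>A B. \<Union>(a, s)\<in>A. \<Union>(b, t)\<in>B. fraction R (a \<otimes>\<^bsub>R\<^esub> b) (s \<otimes>\<^bsub>R\<^esub> t)),
      one = fraction R \<one>\<^bsub>R\<^esub> \<one>\<^bsub>R\<^esub>,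
      zero = fraction R \<zero>\<^bsub>R\<^esub> \<one>\<^bsub>R\<^esub>,
      add = (\<lambda>A B. \<Union>(a, s)\<in>A. \<Union>(b, t)\<in>B.
        fraction R ((a \<otimes>\<^bsub>R\<^esub> t) \<oplus>\<^bsub>R\<^esub> (b \<otimes>\<^bsub>R\<^esub> s)) (s \<otimes>\<^bsub>R\<^esub> t))\<rparr>"

definition integral_over :: "('r, 'm) ring_scheme \<Rightarrow> 'r set \<Rightarrow> 'r \<Rightarrow> bool" where
  "integral_over Q B x \<longleftrightarrow>
     (\<exists>(m::nat) c. (\<forall>i<m. c i \<in> B) \<and>
        (x [^]\<^bsub>Q\<^esub> m) \<oplus>\<^bsub>Q\<^esub> (\<Oplus>\<^bsub>Q\<^esub>i\<in>{..<m}. c i \<otimes>\<^bsub>Q\<^esub> (x [^]\<^bsub>Q\<^esub> i)) = \<zero>\<^bsub>Q\<^esub>)"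

text \<open>
  The normalization of a subring \<open>B\<close> of \<open>Q\<close> all of whose regular elements are units of \<open>Q\<close>: the
  integral closure of \<open>B\<close> in its total ring of fractions, which is contained in \<open>Q\<close>.
\<close>

definition normalization_in :: "('r, 'm) ring_scheme \<Rightarrow> 'r set \<Rightarrow> 'r set" where
  "normalization_in Q B =
     {x \<in> carrier Q.
        (\<exists>a\<in>B. \<exists>s\<in>regular_elements (Q\<lparr>carrier := B\<rparr>). s \<otimes>\<^bsub>Q\<^esub> x = a) \<and> integral_over Q B x}"


section \<open>The curve \<open>y\<^sup>n = g(x)\<close> over a field and its normalization\<close>

text \<open>
  Bivariate polynomials are polynomials in \<open>y\<close> whose coefficients are polynomials in \<open>x\<close>. The
  polynomial \<open>g\<close> has coefficients in the field \<open>k\<close>; the ambient ring is the coordinate ring of the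
  curve over the algebraic closure of \<open>k\<close>, and \<open>curve_form\<close> is the coordinate ring of the curve
  over \<open>k\<close>.
\<close>

definition curve_ideal :: "nat \<Rightarrow> 'k::field poly \<Rightarrow> 'k alg_closure poly poly set" where
  "curve_ideal n g = cgenideal ring_of_type_algebra (monom 1 n - [:map_poly to_ac g:])"

definition curve_ring :: "nat \<Rightarrow> 'k::field poly \<Rightarrow> 'k alg_closure poly poly set ring" where
  "curve_ring n g = FactRing ring_of_type_algebra (curve_ideal n g)"

definition curve_class ::
    "nat \<Rightarrow> 'k::field poly \<Rightarrow> 'k alg_closure poly poly \<Rightarrow> 'k alg_closure poly poly set" where
  "curve_class n g q = a_r_coset ring_of_type_algebra (curve_ideal n g) q"

definition curve_const ::
    "nat \<Rightarrow> 'k::field poly \<Rightarrow> 'k alg_closure \<Rightarrow> 'k alg_closure poly poly set" where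
  "curve_const n g c = curve_class n g [:[:c:]:]"

definition curve_form :: "nat \<Rightarrow> 'k::field poly \<Rightarrow> 'k alg_closure poly poly set set" where
  "curve_form n g = range (\<lambda>q. curve_class n g (map_poly (map_poly to_ac) q))"

definition curve_frac ::
    "nat \<Rightarrow> 'k::field poly \<Rightarrow> 'k alg_closure poly poly set \<Rightarrow>
      ('k alg_closure poly poly set \<times> 'k alg_closure poly poly set) set" where
  "curve_frac n g a = fraction (curve_ring n g) a \<one>\<^bsub>curve_ring n g\<^esub>"

text \<open>
  \<open>curve_components_over n g N M\<close>: the curve has \<open>N\<close> geometric irreducible components, all of them
  defined over \<open>M\<close>; \<open>normalization_components_over\<close> says the same for the normalization of the
  curve, which is taken over \<open>k\<close>.
\<close>

definition curve_components_over ::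
    "nat \<Rightarrow> 'k::field poly \<Rightarrow> nat \<Rightarrow> 'k alg_closure set \<Rightarrow> bool" where
  "curve_components_over n g N M \<longleftrightarrow>
     has_components_over (curve_ring n g) (curve_const n g) (curve_form n g) N M"

definition normalization_components_over ::
    "nat \<Rightarrow> 'k::field poly \<Rightarrow> nat \<Rightarrow> 'k alg_closure set \<Rightarrow> bool" where
  "normalization_components_over n g N M \<longleftrightarrow>
     has_components_over (total_fractions (curve_ring n g))
       (curve_frac n g \<circ> curve_const n g)
       (normalization_in (total_fractions (curve_ring n g)) (curve_frac n g ` curve_form n g))
       N M"

end

theory Submission
  imports Defs
begin

text \<open>
  Substituting \<open>\<pi>\<^sup>\<mu> x + r\<close> in \<open>f = \<Prod>(x - \<beta>)\<close> and removing powers of \<open>\<pi>\<close>, a root outside \<open>s\<close>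
  contributes only a constant to the reduction, while the roots in one child of the cluster reduce
  to the same point and those of different children to different points. Hence the reduced equation
  is \<open>y\<^sup>n = c (\<Prod>(x - b)\<^sup>a)\<close> with \<open>a\<close> running over the sizes of the children, that is
  \<open>y\<^sup>n = (g h)\<^sup>d\<close> with \<open>g\<^sup>d = c\<close>. With \<open>m = n / d\<close> the left minus the right hand side factors as
  the product of the \<open>y\<^sup>m - z\<^sup>j g h\<close>, where \<open>z\<close> is a primitive \<open>d\<close>-th root of unity, and each factor
  is prime because \<open>m\<close> and the orders of vanishing of \<open>h\<close> have no common divisor. The factors give the
  minimal primes of the coordinate ring. The total ring of fractions inherits them, and in the
  normalization they are generated by \<open>y\<^sup>m / h - z\<^sup>j g\<close>.
\<close>

text \<open>The obstacle is the normalization: it is formed over \<open>k\<close> and only then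
  extended to the algebraic closure, and the resulting ring is not computed. The proof uses only
  that this ring lies between the coordinate ring and its total ring of fractions and contains the
  \<open>d\<close> functions \<open>y^m / h - z^j g\<close>. Their differences are nonzero constants
  and their product is zero, so they split every such ring as in the Chinese remainder theorem,
  which determines its minimal primes. Primality of \<open>y^m - z^j g h\<close> is shown in the
  ring of bivariate polynomials itself: the principal ideal is the kernel of an evaluation into an
  algebraically closed field. Since \<open>p\<close> does not divide \<open>n\<close>, the
  \<open>n\<close>-th roots of unity of \<open>K\<close> stay distinct in \<open>k\<close>, so the
  powers of \<open>z\<close> are reductions of elements of \<open>K\<close>. The only other constant
  in the factors is \<open>g\<close>, the reduction of the chosen \<open>d\<close>-th root of
  \<open>c_t\<close>; this is where the field of definition comes from. As the gcd \<open>d\<close>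
  includes \<open>n\<close> besides the sizes of the children, \<open>m = n / d\<close> is an
  integer without a common divisor with all the \<open>a_i / d\<close>.\<close>

section \<open>Irreducible components and minimal primes\<close>

text \<open>Irreducibility is defined by covers with two closed sets only, so a finite cover is
  treated by splitting off one member at a time. The rest must then be closed again: a non-empty
  finite union is cut out by the intersection of the ideals, because a prime that contains an
  intersection of two ideals contains one of them.\<close>

lemma irreducible_subset_finite_cover:
  assumes "finite J" and "\<And>j. j \<in> J \<Longrightarrow> ideal (p j) R" and "irreducible_subset R Z"
    and "Z \<subseteq> (\<Union>j\<in>J. {P \<in> spec R. p j \<subseteq> P})"
  shows "\<exists>j\<in>J. Z \<subseteq> {P \<in> spec R. p j \<subseteq> P}"
  using assms(1,2,4)
proof (induction J rule: finite_induct)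
  case empty
  then show ?case
    using assms(3) by (auto simp: irreducible_subset_def)
next
  case (insert j J)
  have Un_closed: "zariski_closed R (\<Union>i\<in>I. {P \<in> spec R. p i \<subseteq> P})"
    if "finite I" "I \<noteq> {}" "\<And>i. i \<in> I \<Longrightarrow> ideal (p i) R" for I
    using that
  proof (induction I rule: finite_ne_induct)
    case (singleton i)
    then show ?case by (auto simp: zariski_closed_def)
  next
    case (insert i I)
    then obtain L where L: "ideal L R" "(\<Union>i\<in>I. {P \<in> spec R. p i \<subseteq> P}) = {P \<in> spec R. L \<subseteq> P}"
      unfolding zariski_closed_def by auto
    interpret L: ideal L R by fact
    interpret pi: ideal "p i" R using insert by auto
    have *: "p i \<inter> L \<subseteq> P \<longleftrightarrow> p i \<subseteq> P \<or> L \<subseteq> P" if "P \<in> spec R" for P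
    proof -
      interpret P: primeideal P R using that by (simp add: spec_def)
      show ?thesis
      proof
        assume sub: "p i \<inter> L \<subseteq> P"
        show "p i \<subseteq> P \<or> L \<subseteq> P"
        proof (rule ccontr)
          assume "\<not> (p i \<subseteq> P \<or> L \<subseteq> P)"
          then obtain x y where xy: "x \<in> p i" "x \<notin> P" "y \<in> L" "y \<notin> P" by blast
          have "x \<otimes>\<^bsub>R\<^esub> y \<in> p i \<inter> L"
            using xy pi.I_r_closed L.I_l_closed pi.Icarr L.Icarr by auto
          then have "x \<otimes>\<^bsub>R\<^esub> y \<in> P" using sub by auto
          with P.I_prime[OF pi.Icarr[OF xy(1)] L.Icarr[OF xy(3)]] xy show False by simp
        qed
      qed auto
    qed
    have "ideal (p i \<inter> L) R"
      by (rule L.i_intersect) (simp_all add: pi.is_ideal L.is_ideal)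
    moreover have "(\<Union>i\<in>insert i I. {P \<in> spec R. p i \<subseteq> P}) = {P \<in> spec R. p i \<inter> L \<subseteq> P}"
      using L(2) * by auto
    ultimately show ?case
      unfolding zariski_closed_def by blast
  qed
  show ?case
  proof (cases "J = {}")
    case True
    with insert.prems show ?thesis by auto
  next
    case False
    have "zariski_closed R {P \<in> spec R. p j \<subseteq> P}"
      using insert.prems(1) by (auto simp: zariski_closed_def)
    moreover have "zariski_closed R (\<Union>j\<in>J. {P \<in> spec R. p j \<subseteq> P})"
      using Un_closed[of J] insert False by auto
    ultimately have "Z \<subseteq> {P \<in> spec R. p j \<subseteq> P} \<or> Z \<subseteq> (\<Union>j\<in>J. {P \<in> spec R. p j \<subseteq> P})"
      using assms(3) insert.prems(2) unfolding irreducible_subset_def by auto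
    then show ?thesis
      using insert.IH insert.prems(1) by blast
  qed
qed

text \<open>The hypotheses say that the \<open>p j\<close> are the minimal primes. The set of primes
  above \<open>p j\<close> is irreducible because \<open>p j\<close> is its generic point: a closed
  set with the point \<open>p j\<close> contains all primes above it.\<close>

lemma irreducible_components_eq:
  assumes "finite J" and prime: "\<And>j. j \<in> J \<Longrightarrow> primeideal (p j) R"
    and covers: "\<And>q. primeideal q R \<Longrightarrow> \<exists>j\<in>J. p j \<subseteq> q"
    and incomparable: "\<And>i j. i \<in> J \<Longrightarrow> j \<in> J \<Longrightarrow> p i \<subseteq> p j \<Longrightarrow> i = j"
  shows "irreducible_components R = (\<lambda>j. {P \<in> spec R. p j \<subseteq> P}) ` J" (is "_ = ?V ` J")
proof -
  have in_spec: "p j \<in> spec R" if "j \<in> J" for j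
    using prime[OF that] by (simp add: spec_def)
  have irr: "irreducible_subset R (?V j)" if "j \<in> J" for j
    unfolding irreducible_subset_def zariski_closed_def
  proof (intro conjI allI impI)
    show "?V j \<noteq> {}" using in_spec[OF that] by auto
  next
    fix Z1 Z2
    assume "(\<exists>I. ideal I R \<and> Z1 = {P \<in> spec R. I \<subseteq> P}) \<and>
       (\<exists>I. ideal I R \<and> Z2 = {P \<in> spec R. I \<subseteq> P}) \<and> ?V j \<subseteq> Z1 \<union> Z2"
    moreover from this have "p j \<in> Z1 \<or> p j \<in> Z2"
      using in_spec[OF that] by blast
    ultimately show "?V j \<subseteq> Z1 \<or> ?V j \<subseteq> Z2" by blast
  qed auto
  have cover: "\<exists>j\<in>J. Z \<subseteq> ?V j" if "irreducible_subset R Z" for Z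
  proof (rule irreducible_subset_finite_cover[OF \<open>finite J\<close> _ that])
    show "ideal (p j) R" if "j \<in> J" for j
      using prime[OF that] primeideal.axioms(1) by blast
    have "Z \<subseteq> spec R" using that by (simp add: irreducible_subset_def)
    then show "Z \<subseteq> (\<Union>j\<in>J. ?V j)" using covers by (fastforce simp: spec_def)
  qed
  have V_mono: "i = j" if "i \<in> J" "j \<in> J" "?V i \<subseteq> ?V j" for i j
    using incomparable[OF that(2,1)] that(3) in_spec[OF that(1)] by auto
  show ?thesis
  proof (intro equalityI subsetI)
    fix Z assume Z: "Z \<in> irreducible_components R"
    then obtain j where "j \<in> J" "Z \<subseteq> ?V j"
      using cover[of Z] by (auto simp only: irreducible_components_def mem_Collect_eq)
    moreover from this Z irr[of j] have "?V j = Z"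
      by (simp add: irreducible_components_def)
    ultimately show "Z \<in> ?V ` J" by blast
  next
    fix Z assume "Z \<in> ?V ` J"
    then obtain j where j: "j \<in> J" "Z = ?V j" by auto
    have "Z' = Z" if Z': "irreducible_subset R Z'" "Z \<subseteq> Z'" for Z'
    proof -
      obtain i where i: "i \<in> J" "Z' \<subseteq> ?V i" using cover[OF Z'(1)] by auto
      then have "?V j \<subseteq> ?V i" using Z'(2) j(2) by order
      then have "i = j" using V_mono[OF j(1) i(1)] by simp
      with i Z' j show ?thesis by auto
    qed
    with irr j show "Z \<in> irreducible_components R"
      by (auto simp: irreducible_components_def)
  qed
qed

lemma generate_ring_mono:
  assumes "H \<subseteq> H'"
  shows "generate_ring R H \<subseteq> generate_ring R H'"
proof
  fix x assume "x \<in> generate_ring R H"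
  then show "x \<in> generate_ring R H'"
    by induction (use assms in \<open>auto intro: generate_ring.intros\<close>)
qed

lemma (in primeideal) finprod_mem_imp:
  assumes "finite J" "f \<in> J \<rightarrow> carrier R" "finprod R f J \<in> I"
  shows "\<exists>j\<in>J. f j \<in> I"
  using assms
proof (induction J rule: finite_induct)
  case empty
  then show ?case using I_notcarr one_imp_carrier by auto
next
  case (insert j J)
  then have "f j \<otimes> finprod R f J \<in> I" by (simp add: Pi_def)
  then have "f j \<in> I \<or> finprod R f J \<in> I"
    using insert by (intro I_prime) (auto simp: Pi_def)
  with insert show ?case by auto
qed

text \<open>With principal primes both claims can be checked on generators. The vanishing product
  puts some \<open>w j\<close> into every prime, and a component is defined over \<open>M\<close> as
  soon as its generator lies in the coordinate ring over \<open>M\<close>.\<close>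

lemma has_components_over_principal:
  fixes Q :: "('r, 'm) ring_scheme" and \<kappa> :: "'c \<Rightarrow> 'r" and B :: "'r set"
  defines "G \<equiv> geometric_ring Q \<kappa> B"
  assumes G: "cring G" and w: "\<And>j. j < N \<Longrightarrow> w j \<in> base_change Q \<kappa> B M"
    and prime: "\<And>j. j < N \<Longrightarrow> primeideal (cgenideal G (w j)) G"
    and incomparable: "\<And>i j. i < N \<Longrightarrow> j < N \<Longrightarrow> w i \<in> cgenideal G (w j) \<Longrightarrow> i = j"
    and prod: "finprod G w {..<N} = \<zero>\<^bsub>G\<^esub>"
  shows "has_components_over Q \<kappa> B N M"
proof -
  interpret G: cring G by fact
  define p where "p j = cgenideal G (w j)" for j
  have sub: "base_change Q \<kappa> B M \<subseteq> carrier G"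
    unfolding G_def geometric_ring_def base_change_def by (auto intro!: generate_ring_mono)
  have wG: "w j \<in> carrier G" if "j < N" for j
    using w[OF that] sub by auto
  have w_mem: "w j \<in> p j" if "j < N" for j
    using G.cgenideal_self[OF wG[OF that]] by (simp add: p_def)
  have inc: "i = j" if "i < N" "j < N" "p i \<subseteq> p j" for i j
    using incomparable[of i j] that w_mem[of i] by (auto simp: p_def)
  have comps: "irreducible_components G = (\<lambda>j. {P \<in> spec G. p j \<subseteq> P}) ` {..<N}"
  proof (rule irreducible_components_eq)
    fix q assume q: "primeideal q G"
    interpret q: primeideal q G by fact
    have "\<exists>j\<in>{..<N}. w j \<in> q"
      by (rule q.finprod_mem_imp) (auto simp: prod wG)
    then show "\<exists>j\<in>{..<N}. p j \<subseteq> q"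
      unfolding p_def using G.cgenideal_minimal[OF q.is_ideal] by auto
  qed (use prime inc in \<open>auto simp: p_def\<close>)
  have in_spec: "p j \<in> spec G" if "j < N" for j
    using prime[OF that] by (simp add: spec_def p_def)
  have "inj_on (\<lambda>j. {P \<in> spec G. p j \<subseteq> P}) {..<N}"
  proof (rule inj_onI)
    fix i j assume ij: "i \<in> {..<N}" "j \<in> {..<N}"
      "{P \<in> spec G. p i \<subseteq> P} = {P \<in> spec G. p j \<subseteq> P}"
    then have "p j \<in> {P \<in> spec G. p i \<subseteq> P}" using in_spec by auto
    then have "p i \<subseteq> p j" by simp
    then show "i = j" using inc ij by simp
  qed
  then have "card (irreducible_components G) = N"
    by (simp add: comps card_image)
  moreover have "defined_over Q \<kappa> B M Z" if Z: "Z \<in> irreducible_components G" for Z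
  proof -
    obtain j where j: "j < N" "Z = {P \<in> spec G. p j \<subseteq> P}"
      using Z comps by auto
    \<comment> \<open>The prime \<open>p j\<close> is itself a point of \<open>Z\<close>, so the
      vanishing ideal of \<open>Z\<close> is \<open>p j\<close>.\<close>
    have Int: "\<Inter>Z = p j" using j in_spec by auto
    have pj: "ideal (p j) G" using prime[OF j(1)] primeideal.axioms(1) by (auto simp: p_def)
    have "p j = genideal G {w j}"
      by (simp add: p_def G.cgenideal_eq_genideal wG j(1))
    also have "\<dots> \<subseteq> genideal G (p j \<inter> base_change Q \<kappa> B M)"
      by (rule G.subset_Idl_subset) (use sub w w_mem j(1) in auto)
    finally have "p j = genideal G (p j \<inter> base_change Q \<kappa> B M)"
      using G.genideal_minimal[OF pj, of "p j \<inter> base_change Q \<kappa> B M"] by auto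
    then show ?thesis by (simp add: defined_over_def Int G_def)
  qed
  ultimately show ?thesis by (simp add: has_components_over_def G_def)
qed

section \<open>The total ring of fractions\<close>

context cring
begin

lemma regular_elements_carrier: "s \<in> regular_elements R \<Longrightarrow> s \<in> carrier R"
  by (simp add: regular_elements_def)

lemma one_regular: "\<one> \<in> regular_elements R"
  by (simp add: regular_elements_def)

lemma regular_cancel:
  assumes "s \<in> regular_elements R" "x \<in> carrier R" "y \<in> carrier R" "s \<otimes> x = s \<otimes> y"
  shows "x = y"
proof -
  have "s \<otimes> (x \<ominus> y) = \<zero>"
    using assms regular_elements_carrier by (simp add: r_minus a_minus_def r_distr r_neg)
  then have "x \<ominus> y = \<zero>" using assms(1-3) unfolding regular_elements_def by blast
  then show ?thesis using assms(2,3) r_right_minus_eq by blast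
qed

lemma regular_mult:
  assumes "s \<in> regular_elements R" "t \<in> regular_elements R"
  shows "s \<otimes> t \<in> regular_elements R"
  unfolding regular_elements_def
proof (intro CollectI conjI ballI impI)
  have carr: "s \<in> carrier R" "t \<in> carrier R" using assms regular_elements_carrier by auto
  then show "s \<otimes> t \<in> carrier R" by simp
  fix a assume a: "a \<in> carrier R" "s \<otimes> t \<otimes> a = \<zero>"
  then have "s \<otimes> (t \<otimes> a) = \<zero>" using carr by (simp add: m_assoc)
  then have "t \<otimes> a = \<zero>" using assms(1) carr a(1) unfolding regular_elements_def by blast
  then show "a = \<zero>" using assms(2) a(1) unfolding regular_elements_def by blast
qed

lemma fraction_mem_iff:
  "(b, t) \<in> fraction R a s \<longleftrightarrow> b \<in> carrier R \<and> t \<in> regular_elements R \<and> a \<otimes> t = b \<otimes> s"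
  by (simp add: fraction_def)

lemma fraction_eq_iff:
  assumes "a \<in> carrier R" "s \<in> regular_elements R" "b \<in> carrier R" "t \<in> regular_elements R"
  shows "fraction R a s = fraction R b t \<longleftrightarrow> a \<otimes> t = b \<otimes> s"
proof
  assume "fraction R a s = fraction R b t"
  then have "(b, t) \<in> fraction R a s" using assms by (simp add: fraction_mem_iff m_comm)
  then show "a \<otimes> t = b \<otimes> s" by (simp add: fraction_mem_iff)
next
  have *: "fraction R a s \<subseteq> fraction R b t"
    if "a \<in> carrier R" "s \<in> regular_elements R" "b \<in> carrier R" "t \<in> regular_elements R"
      and eq: "a \<otimes> t = b \<otimes> s" for a b s t
  proof
    fix x assume "x \<in> fraction R a s"
    then obtain c u where cu: "x = (c, u)" "c \<in> carrier R" "u \<in> regular_elements R" "a \<otimes> u = c \<otimes> s"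
      by (cases x) (auto simp: fraction_mem_iff)
    have carr: "a \<in> carrier R" "b \<in> carrier R" "c \<in> carrier R" "s \<in> carrier R" "t \<in> carrier R"
      "u \<in> carrier R" using that cu regular_elements_carrier by auto
    have "s \<otimes> (b \<otimes> u) = (a \<otimes> t) \<otimes> u" using carr by (simp add: eq m_ac)
    moreover have "(a \<otimes> t) \<otimes> u = (a \<otimes> u) \<otimes> t" using carr by (simp add: m_ac)
    moreover have "(a \<otimes> u) \<otimes> t = s \<otimes> (c \<otimes> t)" using carr by (simp add: cu(4) m_ac)
    ultimately have "s \<otimes> (b \<otimes> u) = s \<otimes> (c \<otimes> t)" by (simp only:)
    from regular_cancel[OF that(2) _ _ this] have "b \<otimes> u = c \<otimes> t" by (simp only: carr m_closed)
    then show "x \<in> fraction R b t" using cu by (simp add: fraction_mem_iff)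
  qed
  assume "a \<otimes> t = b \<otimes> s"
  then show "fraction R a s = fraction R b t"
    using *[OF assms] *[OF assms(3,4,1,2)] by (simp add: subset_antisym)
qed

lemma fraction_self:
  assumes "a \<in> carrier R" "s \<in> regular_elements R"
  shows "(a, s) \<in> fraction R a s"
  using assms by (simp add: fraction_mem_iff)

lemma carrier_total_fractions:
  "carrier (total_fractions R) = {fraction R a s | a s. a \<in> carrier R \<and> s \<in> regular_elements R}"
  by (simp add: total_fractions_def)

lemma fraction_carrier:
  assumes "a \<in> carrier R" "s \<in> regular_elements R"
  shows "fraction R a s \<in> carrier (total_fractions R)"
  using assms by (auto simp: carrier_total_fractions)

lemma one_total_fractions: "\<one>\<^bsub>total_fractions R\<^esub> = fraction R \<one> \<one>"
  and zero_total_fractions: "\<zero>\<^bsub>total_fractions R\<^esub> = fraction R \<zero> \<one>"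
  by (simp_all add: total_fractions_def)

text \<open>The operations of \<open>total_fractions\<close> are unions over all representatives.
  They collapse to one class because every choice of representatives yields the same class.\<close>

lemma mult_fraction:
  assumes "a \<in> carrier R" "s \<in> regular_elements R" "b \<in> carrier R" "t \<in> regular_elements R"
  shows "fraction R a s \<otimes>\<^bsub>total_fractions R\<^esub> fraction R b t = fraction R (a \<otimes> b) (s \<otimes> t)"
proof -
  have "fraction R (a' \<otimes> b') (s' \<otimes> t') = fraction R (a \<otimes> b) (s \<otimes> t)"
    if "(a', s') \<in> fraction R a s" "(b', t') \<in> fraction R b t" for a' s' b' t'
  proof -
    have eqs: "a \<otimes> s' = a' \<otimes> s" "b \<otimes> t' = b' \<otimes> t" using that by (simp_all add: fraction_mem_iff)
    have reg: "s' \<in> regular_elements R" "t' \<in> regular_elements R"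
      using that by (simp_all add: fraction_mem_iff)
    have carr: "a \<in> carrier R" "b \<in> carrier R" "s \<in> carrier R" "t \<in> carrier R"
      "a' \<in> carrier R" "b' \<in> carrier R" "s' \<in> carrier R" "t' \<in> carrier R"
      using that assms regular_elements_carrier by (auto simp: fraction_mem_iff)
    have "(a' \<otimes> b') \<otimes> (s \<otimes> t) = (a' \<otimes> s) \<otimes> (b' \<otimes> t)" using carr by (simp add: m_ac)
    also have "\<dots> = (a \<otimes> s') \<otimes> (b \<otimes> t')" by (simp add: eqs)
    also have "\<dots> = (a \<otimes> b) \<otimes> (s' \<otimes> t')" using carr by (simp add: m_ac)
    finally show ?thesis using carr assms reg by (subst fraction_eq_iff) (auto intro: regular_mult)
  qed
  moreover have "(a, s) \<in> fraction R a s" "(b, t) \<in> fraction R b t"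
    using assms fraction_self by auto
  ultimately have
    "(\<Union>(a, s)\<in>fraction R a s. \<Union>(b, t)\<in>fraction R b t. fraction R (a \<otimes> b) (s \<otimes> t))
      = fraction R (a \<otimes> b) (s \<otimes> t)" by fast
  then show ?thesis by (simp add: total_fractions_def)
qed

lemma add_fraction:
  assumes "a \<in> carrier R" "s \<in> regular_elements R" "b \<in> carrier R" "t \<in> regular_elements R"
  shows "fraction R a s \<oplus>\<^bsub>total_fractions R\<^esub> fraction R b t
    = fraction R (a \<otimes> t \<oplus> b \<otimes> s) (s \<otimes> t)"
proof -
  have "fraction R (a' \<otimes> t' \<oplus> b' \<otimes> s') (s' \<otimes> t') = fraction R (a \<otimes> t \<oplus> b \<otimes> s) (s \<otimes> t)"
    if "(a', s') \<in> fraction R a s" "(b', t') \<in> fraction R b t" for a' s' b' t'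
  proof -
    have eqs: "a \<otimes> s' = a' \<otimes> s" "b \<otimes> t' = b' \<otimes> t" using that by (simp_all add: fraction_mem_iff)
    have reg: "s' \<in> regular_elements R" "t' \<in> regular_elements R"
      using that by (simp_all add: fraction_mem_iff)
    have carr: "a \<in> carrier R" "b \<in> carrier R" "s \<in> carrier R" "t \<in> carrier R"
      "a' \<in> carrier R" "b' \<in> carrier R" "s' \<in> carrier R" "t' \<in> carrier R"
      using that assms regular_elements_carrier by (auto simp: fraction_mem_iff)
    have "(a' \<otimes> t' \<oplus> b' \<otimes> s') \<otimes> (s \<otimes> t)
        = (a' \<otimes> s) \<otimes> (t' \<otimes> t) \<oplus> (b' \<otimes> t) \<otimes> (s' \<otimes> s)"
      using carr by (simp add: m_ac l_distr r_distr)
    also have "\<dots> = (a \<otimes> s') \<otimes> (t' \<otimes> t) \<oplus> (b \<otimes> t') \<otimes> (s' \<otimes> s)" by (simp add: eqs)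
    also have "\<dots> = (a \<otimes> t \<oplus> b \<otimes> s) \<otimes> (s' \<otimes> t')" using carr by (simp add: m_ac l_distr r_distr)
    finally show ?thesis using carr assms reg by (subst fraction_eq_iff) (auto intro: regular_mult)
  qed
  moreover have "(a, s) \<in> fraction R a s" "(b, t) \<in> fraction R b t"
    using assms fraction_self by auto
  ultimately have
    "(\<Union>(a, s)\<in>fraction R a s. \<Union>(b, t)\<in>fraction R b t. fraction R (a \<otimes> t \<oplus> b \<otimes> s) (s \<otimes> t))
      = fraction R (a \<otimes> t \<oplus> b \<otimes> s) (s \<otimes> t)" by fast
  then show ?thesis by (simp add: total_fractions_def)
qed

lemma total_fractions_cases:
  assumes "x \<in> carrier (total_fractions R)"
  obtains a s where "a \<in> carrier R" "s \<in> regular_elements R" "x = fraction R a s"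
  using assms by (auto simp: carrier_total_fractions)

lemma cring_total_fractions: "cring (total_fractions R)"
proof (rule cringI)
  let ?Q = "total_fractions R"
  note carr = regular_elements_carrier one_regular regular_mult fraction_carrier
  note ops = mult_fraction add_fraction one_total_fractions zero_total_fractions
  show "abelian_group ?Q"
  proof (rule abelian_groupI)
    fix x assume "x \<in> carrier ?Q"
    then obtain a s where x: "a \<in> carrier R" "s \<in> regular_elements R" "x = fraction R a s"
      by (rule total_fractions_cases)
    show "\<zero>\<^bsub>?Q\<^esub> \<oplus>\<^bsub>?Q\<^esub> x = x"
      using x by (simp add: carr ops)
    have "fraction R (\<ominus> a) s \<oplus>\<^bsub>?Q\<^esub> x = \<zero>\<^bsub>?Q\<^esub>"
      using x by (simp add: carr ops fraction_eq_iff l_minus l_neg)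
    then show "\<exists>y\<in>carrier ?Q. y \<oplus>\<^bsub>?Q\<^esub> x = \<zero>\<^bsub>?Q\<^esub>"
      using x by (intro bexI[of _ "fraction R (\<ominus> a) s"]) (simp_all add: carr)
  next
    fix x y assume "x \<in> carrier ?Q" "y \<in> carrier ?Q"
    then obtain a s b t where x: "a \<in> carrier R" "s \<in> regular_elements R" "x = fraction R a s"
      and y: "b \<in> carrier R" "t \<in> regular_elements R" "y = fraction R b t"
      by (auto elim!: total_fractions_cases)
    show "x \<oplus>\<^bsub>?Q\<^esub> y \<in> carrier ?Q"
      using x y by (simp add: carr ops)
    show "x \<oplus>\<^bsub>?Q\<^esub> y = y \<oplus>\<^bsub>?Q\<^esub> x"
      using x y by (simp add: carr ops m_comm a_comm)
    fix z assume "z \<in> carrier ?Q"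
    then obtain c u where z: "c \<in> carrier R" "u \<in> regular_elements R" "z = fraction R c u"
      by (rule total_fractions_cases)
    show "x \<oplus>\<^bsub>?Q\<^esub> y \<oplus>\<^bsub>?Q\<^esub> z = x \<oplus>\<^bsub>?Q\<^esub> (y \<oplus>\<^bsub>?Q\<^esub> z)"
      using x y z by (simp add: carr ops m_ac l_distr r_distr a_ac)
  qed (simp add: carr ops)
  show "comm_monoid ?Q"
  proof (rule comm_monoidI)
    fix x assume "x \<in> carrier ?Q"
    then obtain a s where x: "a \<in> carrier R" "s \<in> regular_elements R" "x = fraction R a s"
      by (rule total_fractions_cases)
    show "\<one>\<^bsub>?Q\<^esub> \<otimes>\<^bsub>?Q\<^esub> x = x"
      using x by (simp add: carr ops)
  next
    fix x y assume "x \<in> carrier ?Q" "y \<in> carrier ?Q"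
    then obtain a s b t where x: "a \<in> carrier R" "s \<in> regular_elements R" "x = fraction R a s"
      and y: "b \<in> carrier R" "t \<in> regular_elements R" "y = fraction R b t"
      by (auto elim!: total_fractions_cases)
    show "x \<otimes>\<^bsub>?Q\<^esub> y \<in> carrier ?Q"
      using x y by (simp add: carr ops)
    show "x \<otimes>\<^bsub>?Q\<^esub> y = y \<otimes>\<^bsub>?Q\<^esub> x"
      using x y by (simp add: carr ops m_comm)
    fix z assume "z \<in> carrier ?Q"
    then obtain c u where z: "c \<in> carrier R" "u \<in> regular_elements R" "z = fraction R c u"
      by (rule total_fractions_cases)
    show "x \<otimes>\<^bsub>?Q\<^esub> y \<otimes>\<^bsub>?Q\<^esub> z = x \<otimes>\<^bsub>?Q\<^esub> (y \<otimes>\<^bsub>?Q\<^esub> z)"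
      using x y z by (simp add: carr ops m_assoc)
  qed (simp add: carr ops)
  fix x y z assume "x \<in> carrier ?Q" "y \<in> carrier ?Q" "z \<in> carrier ?Q"
  then obtain a s b t c u where x: "a \<in> carrier R" "s \<in> regular_elements R" "x = fraction R a s"
    and y: "b \<in> carrier R" "t \<in> regular_elements R" "y = fraction R b t"
    and z: "c \<in> carrier R" "u \<in> regular_elements R" "z = fraction R c u"
    by (auto elim!: total_fractions_cases)
  \<comment> \<open>The two sides of the distributive law have the denominators
    \<open>(s t) u\<close> and \<open>(s u) (t u)\<close>, so it is compared in cross-multiplied
    form.\<close>
  have "((a \<otimes> t \<oplus> b \<otimes> s) \<otimes> c) \<otimes> ((s \<otimes> u) \<otimes> (t \<otimes> u))
      = ((a \<otimes> c) \<otimes> (t \<otimes> u) \<oplus> (b \<otimes> c) \<otimes> (s \<otimes> u)) \<otimes> ((s \<otimes> t) \<otimes> u)"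
    using x y z by (simp add: carr m_ac l_distr r_distr)
  then show "(x \<oplus>\<^bsub>?Q\<^esub> y) \<otimes>\<^bsub>?Q\<^esub> z = x \<otimes>\<^bsub>?Q\<^esub> z \<oplus>\<^bsub>?Q\<^esub> y \<otimes>\<^bsub>?Q\<^esub> z"
    using x y z by (simp add: carr ops fraction_eq_iff)
qed

lemma finprod_fraction:
  assumes "finite J" "W \<in> J \<rightarrow> carrier R" "h \<in> regular_elements R"
  shows "finprod (total_fractions R) (\<lambda>j. fraction R (W j) h) J
    = fraction R (finprod R W J) (h [^] card J)"
proof -
  interpret Q: cring "total_fractions R" by (rule cring_total_fractions)
  have pow: "h [^] (n::nat) \<in> regular_elements R" for n
    using assms(3) by (induction n) (simp_all add: one_regular regular_mult)
  show ?thesis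
    using assms(1,2)
  proof (induction J rule: finite_induct)
    case empty
    then show ?case by (simp add: one_total_fractions)
  next
    case (insert j J)
    have carr: "h \<in> carrier R" "W \<in> J \<rightarrow> carrier R" "W j \<in> carrier R"
      using insert.prems assms(3) regular_elements_carrier by auto
    have "(\<lambda>j. fraction R (W j) h) \<in> J \<rightarrow> carrier (total_fractions R)"
      using carr(2) assms(3) by (auto intro: fraction_carrier)
    then have "finprod (total_fractions R) (\<lambda>j. fraction R (W j) h) (insert j J)
        = fraction R (W j) h \<otimes>\<^bsub>total_fractions R\<^esub> fraction R (finprod R W J) (h [^] card J)"
      using insert carr assms(3) fraction_carrier by simp
    also have "\<dots> = fraction R (W j \<otimes> finprod R W J) (h \<otimes> h [^] card J)"
      using carr assms(3) pow by (intro mult_fraction) simp_all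
    finally show ?case
      using insert carr by (simp add: m_comm)
  qed
qed

end

section \<open>Subrings of the total ring of fractions\<close>

lemma (in cring) finprod_subring:
  assumes "subring H R" "finite J" "f \<in> J \<rightarrow> H"
  shows "finprod (R\<lparr>carrier := H\<rparr>) f J = finprod R f J"
proof -
  interpret H: cring "R\<lparr>carrier := H\<rparr>"
    using subcring_iff[OF subringE(1)[OF assms(1)]] subcringI'[OF assms(1)] by simp
  have HR: "H \<subseteq> carrier R" using subringE(1)[OF assms(1)] .
  show ?thesis
    using assms(2,3)
  proof (induction J rule: finite_induct)
    case (insert j J)
    then have "f \<in> J \<rightarrow> carrier R" "f j \<in> carrier R" using HR by auto
    with insert HR show ?case by auto
  qed simp
qed

text \<open>Modulo \<open>x\<close> every factor is a unit of the ring, hence so is the product. It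
  is applied with \<open>x = w j\<close> and all the other \<open>w i\<close> as factors.\<close>

lemma (in cring) finprod_unit_plus_multiple:
  assumes "finite J" "x \<in> carrier R" "\<And>i. i \<in> J \<Longrightarrow> \<exists>k\<in>Units R. w i = k \<oplus> x"
  shows "\<exists>k\<in>Units R. \<exists>q\<in>carrier R. finprod R w J = k \<oplus> q \<otimes> x"
  using assms(1,3)
proof (induction J rule: finite_induct)
  case empty
  then show ?case
    using assms(2) by (intro bexI[of _ \<one>] bexI[of _ \<zero>]) simp_all
next
  case (insert i J)
  then obtain k q where k: "k \<in> Units R" "q \<in> carrier R" "finprod R w J = k \<oplus> q \<otimes> x" by auto
  obtain l where l: "l \<in> Units R" "w i = l \<oplus> x" using insert.prems by auto
  have carr: "k \<in> carrier R" "l \<in> carrier R" using k l by (auto intro: Units_closed)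
  have "w j \<in> carrier R" if "j \<in> insert i J" for j
    using insert.prems[OF that] assms(2) by (auto intro: Units_closed)
  then have "finprod R w (insert i J) = w i \<otimes> finprod R w J"
    using insert.hyps by (intro finprod_insert) auto
  also have "\<dots> = l \<otimes> k \<oplus> (l \<otimes> q \<oplus> k \<oplus> x \<otimes> q) \<otimes> x"
    unfolding k l using carr k(2) assms(2) by (simp add: l_distr r_distr m_ac a_ac)
  finally show ?case
    using carr k l assms(2) by (intro bexI[of _ "l \<otimes> k"] bexI[of _ "l \<otimes> q \<oplus> k \<oplus> x \<otimes> q"]) auto
qed

text \<open>
  Modulo \<open>w j\<close> every other \<open>w i\<close> is a unit of \<open>H\<close> while the product of all of them vanishes, so an
  element of \<open>H\<close> whose numerator is a multiple of \<open>W j\<close> is a multiple of \<open>w j\<close> already in \<open>H\<close>.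
\<close>

lemma (in cring) total_fractions_overring_primes:
  fixes W :: "nat \<Rightarrow> 'a" and h :: 'a and N :: nat and H :: "('a \<times> 'a) set set"
  defines "Q \<equiv> total_fractions R"
  defines "G \<equiv> Q\<lparr>carrier := H\<rparr>"
  defines "w \<equiv> \<lambda>j. fraction R (W j) h"
  assumes H: "subring H Q" and frac_H: "\<And>x. x \<in> carrier R \<Longrightarrow> fraction R x \<one> \<in> H"
    and h: "h \<in> regular_elements R"
    and W: "\<And>j. j < N \<Longrightarrow> W j \<in> carrier R"
    and prime: "\<And>j. j < N \<Longrightarrow> primeideal (PIdl (W j)) R"
    and incomparable: "\<And>i j. i < N \<Longrightarrow> j < N \<Longrightarrow> W i \<in> PIdl (W j) \<Longrightarrow> i = j"
    and prod: "finprod R W {..<N} = \<zero>"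
    and w: "\<And>j. j < N \<Longrightarrow> w j \<in> H"
    and diff: "\<And>i j. i < N \<Longrightarrow> j < N \<Longrightarrow> i \<noteq> j \<Longrightarrow> \<exists>k\<in>Units R. W i = k \<otimes> h \<oplus> W j"
  shows "\<And>j. j < N \<Longrightarrow> primeideal (cgenideal G (w j)) G"
    and "\<And>i j. i < N \<Longrightarrow> j < N \<Longrightarrow> w i \<in> cgenideal G (w j) \<Longrightarrow> i = j"
    and "finprod G w {..<N} = \<zero>\<^bsub>G\<^esub>"
proof -
  interpret Q: cring Q unfolding Q_def by (rule cring_total_fractions)
  interpret G: cring G
    using Q.subcring_iff[OF subringE(1)[OF H]] Q.subcringI'[OF H] by (simp add: G_def)
  have HQ: "H \<subseteq> carrier Q" using H subringE(1) by auto
  have G_simps [simp]: "carrier G = H" "monoid.mult G = monoid.mult Q" "one G = one Q" "zero G = zero Q"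
    "add G = add Q" by (simp_all add: G_def)
  have hR: "h \<in> carrier R" using h regular_elements_carrier by blast
  have pow: "h [^] (n::nat) \<in> regular_elements R" for n
    using h by (induction n) (simp_all add: one_regular regular_mult)
  have "finprod G w {..<N} = finprod Q w {..<N}"
    unfolding G_def by (rule Q.finprod_subring) (use H w in auto)
  also have "\<dots> = fraction R (finprod R W {..<N}) (h [^] N)"
    unfolding w_def Q_def by (subst finprod_fraction) (use W h in auto)
  also have "\<dots> = \<zero>\<^bsub>Q\<^esub>"
    unfolding Q_def zero_total_fractions prod
    using pow regular_elements_carrier by (subst fraction_eq_iff) (auto simp: one_regular)
  finally show prod_w: "finprod G w {..<N} = \<zero>\<^bsub>G\<^esub>" by simp
  \<comment> \<open>If \<open>s = x W j\<close> were regular, it would annihilate the product of the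
    other \<open>W i\<close>. That product would then be zero, hence in the prime of
    \<open>W j\<close>, and so would some \<open>W i\<close>, against incomparability.\<close>
  have regular_notin: "s \<notin> PIdl (W j)" if j: "j < N" and s: "s \<in> regular_elements R" for s j
  proof
    assume "s \<in> PIdl (W j)"
    then obtain x where x: "x \<in> carrier R" "s = x \<otimes> W j" by (auto simp: cgenideal_def)
    interpret p: primeideal "PIdl (W j)" R using prime[OF j] .
    let ?E = "finprod R W ({..<N} - {j})"
    have E: "?E \<in> carrier R" using W by (intro finprod_closed) auto
    have "W j \<otimes> ?E = finprod R W (insert j ({..<N} - {j}))"
      using W j by (subst finprod_insert) auto
    also have "insert j ({..<N} - {j}) = {..<N}" using j by auto
    finally have "s \<otimes> ?E = \<zero>" using x W[OF j] E prod by (simp add: m_assoc)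
    then have "?E = \<zero>" using s E unfolding regular_elements_def by blast
    then have "?E \<in> PIdl (W j)" by simp
    then obtain i where "i \<in> {..<N} - {j}" "W i \<in> PIdl (W j)"
      using p.finprod_mem_imp[of "{..<N} - {j}" W] W by auto
    then show False using incomparable j by auto
  qed
  \<comment> \<open>This transports the primes: membership in the ideal of \<open>H\<close> is read
    off from the numerator in \<open>R\<close>, since denominators avoid the prime of
    \<open>W j\<close>.\<close>
  have mem_iff: "fraction R a s \<in> cgenideal G (w j) \<longleftrightarrow> a \<in> PIdl (W j)"
    if j: "j < N" and a: "a \<in> carrier R" and s: "s \<in> regular_elements R"
      and inH: "fraction R a s \<in> H" for a s j
  proof
    interpret p: primeideal "PIdl (W j)" R using prime[OF j] .
    assume "fraction R a s \<in> cgenideal G (w j)"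
    then obtain y where y: "y \<in> H" "fraction R a s = y \<otimes>\<^bsub>Q\<^esub> w j"
      unfolding cgenideal_def G_simps by blast
    have "y \<in> carrier (total_fractions R)" using y(1) HQ by (auto simp: Q_def)
    then obtain b t where b: "b \<in> carrier R" "t \<in> regular_elements R" "y = fraction R b t"
      by (rule total_fractions_cases)
    have "fraction R a s = fraction R (b \<otimes> W j) (t \<otimes> h)"
      using y b h W[OF j] by (simp add: w_def Q_def mult_fraction)
    then have "a \<otimes> (t \<otimes> h) = (b \<otimes> W j) \<otimes> s"
      using a s b h W[OF j] by (subst (asm) fraction_eq_iff) (simp_all add: regular_mult)
    also have "\<dots> = (b \<otimes> s) \<otimes> W j"
      using b(1) W[OF j] regular_elements_carrier[OF s] by (simp add: m_ac)
    also have "\<dots> \<in> PIdl (W j)"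
      using b(1) regular_elements_carrier[OF s] unfolding cgenideal_def by blast
    finally have "a \<otimes> (t \<otimes> h) \<in> PIdl (W j)" .
    moreover have "t \<otimes> h \<notin> PIdl (W j)"
      using regular_notin[OF j] regular_mult[OF b(2) h] by blast
    ultimately show "a \<in> PIdl (W j)"
      using p.I_prime[OF a m_closed[OF regular_elements_carrier[OF b(2)] hR]] by simp
  next
    assume "a \<in> PIdl (W j)"
    then obtain y where y: "y \<in> carrier R" "a = y \<otimes> W j" by (auto simp: cgenideal_def)
    define x where "x = fraction R a s"
    \<comment> \<open>The quotient \<open>z\<close> of \<open>x\<close> by \<open>w j\<close> lies
      in \<open>Q\<close> but perhaps not in \<open>H\<close>. It only shows that the product of the
      other \<open>w i\<close> annihilates \<open>x\<close>. That product is
      \<open>k + q (w j)\<close> with a unit \<open>k\<close> of \<open>H\<close>, so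
      \<open>x = - inv k x q (w j)\<close>, a multiple with a factor in \<open>H\<close>.\<close>
    define z where "z = fraction R (y \<otimes> h) s"
    have sR: "s \<in> carrier R" using s regular_elements_carrier by blast
    have xz: "x = z \<otimes>\<^bsub>Q\<^esub> w j" "z \<in> carrier Q"
      unfolding x_def z_def w_def Q_def y
      using y(1) s h hR sR W[OF j]
      by (simp_all add: mult_fraction fraction_eq_iff regular_mult fraction_carrier m_ac)
    let ?J = "{..<N} - {j}"
    have wG: "w \<in> {..<N} \<rightarrow> carrier G" using w by auto
    have "\<exists>k\<in>Units G. w i = k \<oplus>\<^bsub>G\<^esub> w j" if i: "i \<in> ?J" for i
    proof -
      obtain k where k: "k \<in> Units R" "W i = k \<otimes> h \<oplus> W j"
        using diff[of i j] i j by auto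
      have kR: "k \<in> carrier R" "inv k \<in> carrier R" using k(1) by auto
      have "fraction R k \<one> \<otimes>\<^bsub>Q\<^esub> fraction R (inv k) \<one> = \<one>\<^bsub>Q\<^esub>"
        "fraction R (inv k) \<one> \<otimes>\<^bsub>Q\<^esub> fraction R k \<one> = \<one>\<^bsub>Q\<^esub>"
        using k(1) kR unfolding Q_def one_total_fractions
        by (simp_all add: mult_fraction one_regular)
      then have "fraction R k \<one> \<in> Units G"
        using frac_H[OF kR(1)] frac_H[OF kR(2)] unfolding Units_def by auto
      moreover have "w i = fraction R k \<one> \<oplus>\<^bsub>Q\<^esub> w j"
        unfolding w_def Q_def k(2) using kR(1) h hR W[OF j]
        by (simp add: add_fraction one_regular)
      ultimately show ?thesis by auto
    qed
    then obtain k q where k: "k \<in> Units G" "q \<in> H" "finprod G w ?J = k \<oplus>\<^bsub>Q\<^esub> q \<otimes>\<^bsub>Q\<^esub> w j"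
      using G.finprod_unit_plus_multiple[of ?J "w j" w] w[OF j] by auto
    have EH: "finprod G w ?J \<in> H" using wG G.finprod_closed[of w ?J] by auto
    have "w j \<otimes>\<^bsub>Q\<^esub> finprod G w ?J = finprod G w (insert j ?J)"
      using wG j by (subst G.finprod_insert) auto
    also have "insert j ?J = {..<N}" using j by auto
    finally have E0: "w j \<otimes>\<^bsub>Q\<^esub> finprod G w ?J = \<zero>\<^bsub>Q\<^esub>" using prod_w by simp
    have "x \<otimes>\<^bsub>Q\<^esub> finprod G w ?J = z \<otimes>\<^bsub>Q\<^esub> (w j \<otimes>\<^bsub>Q\<^esub> finprod G w ?J)"
      unfolding xz(1) using xz(2) w[OF j] EH HQ by (intro Q.m_assoc) auto
    also have "\<dots> = \<zero>\<^bsub>Q\<^esub>" using E0 xz(2) by simp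
    finally have "x \<otimes>\<^bsub>G\<^esub> (k \<oplus>\<^bsub>G\<^esub> q \<otimes>\<^bsub>G\<^esub> w j) = \<zero>\<^bsub>G\<^esub>" using k(3) by simp
    moreover have xG: "x \<in> carrier G" using inH by (simp add: x_def)
    moreover have carrG: "k \<in> carrier G" "q \<in> carrier G" "w j \<in> carrier G" "inv\<^bsub>G\<^esub> k \<in> carrier G"
      using k w[OF j] G.Units_closed G.Units_inv_closed by auto
    ultimately have "k \<otimes>\<^bsub>G\<^esub> x \<oplus>\<^bsub>G\<^esub> (x \<otimes>\<^bsub>G\<^esub> q) \<otimes>\<^bsub>G\<^esub> w j = \<zero>\<^bsub>G\<^esub>"
      by (simp del: G_simps add: G.r_distr G.m_ac)
    then have "k \<otimes>\<^bsub>G\<^esub> x = \<ominus>\<^bsub>G\<^esub> ((x \<otimes>\<^bsub>G\<^esub> q) \<otimes>\<^bsub>G\<^esub> w j)"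
      using xG carrG by (intro G.minus_equality[symmetric]) (simp_all del: G_simps)
    then have "inv\<^bsub>G\<^esub> k \<otimes>\<^bsub>G\<^esub> (k \<otimes>\<^bsub>G\<^esub> x) = (inv\<^bsub>G\<^esub> k \<otimes>\<^bsub>G\<^esub> \<ominus>\<^bsub>G\<^esub> (x \<otimes>\<^bsub>G\<^esub> q)) \<otimes>\<^bsub>G\<^esub> w j"
      using xG carrG by (simp del: G_simps add: G.l_minus G.m_assoc)
    moreover have "inv\<^bsub>G\<^esub> k \<otimes>\<^bsub>G\<^esub> (k \<otimes>\<^bsub>G\<^esub> x) = x"
      using xG carrG k(1) by (simp del: G_simps add: G.Units_l_inv flip: G.m_assoc)
    ultimately show "fraction R a s \<in> cgenideal G (w j)"
      unfolding cgenideal_def x_def[symmetric] using xG carrG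
      by (intro CollectI exI[of _ "inv\<^bsub>G\<^esub> k \<otimes>\<^bsub>G\<^esub> \<ominus>\<^bsub>G\<^esub> (x \<otimes>\<^bsub>G\<^esub> q)"])
        (simp del: G_simps)
  qed
  show "i = j" if "i < N" "j < N" "w i \<in> cgenideal G (w j)" for i j
    using mem_iff[OF that(2) W[OF that(1)] h] that w[OF that(1)] incomparable
    by (simp add: w_def)
  show "primeideal (cgenideal G (w j)) G" if j: "j < N" for j
  proof (rule primeidealI)
    interpret p: primeideal "PIdl (W j)" R using prime[OF j] .
    show "ideal (cgenideal G (w j)) G"
      using w[OF j] by (intro G.cgenideal_ideal) simp
    show "cring G" by (rule G.is_cring)
    have "\<one> \<notin> PIdl (W j)" using p.I_notcarr p.one_imp_carrier by metis
    then have "fraction R \<one> \<one> \<notin> cgenideal G (w j)"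
      using mem_iff[OF j one_closed one_regular frac_H[OF one_closed]] by simp
    then show "carrier G \<noteq> cgenideal G (w j)" using frac_H[OF one_closed] unfolding G_simps by metis
    fix x y assume xy: "x \<in> carrier G" "y \<in> carrier G" "x \<otimes>\<^bsub>G\<^esub> y \<in> cgenideal G (w j)"
    have "x \<in> carrier (total_fractions R)" using xy(1) HQ by (auto simp: Q_def)
    then obtain a s where a: "a \<in> carrier R" "s \<in> regular_elements R" "x = fraction R a s"
      by (rule total_fractions_cases)
    have "y \<in> carrier (total_fractions R)" using xy(2) HQ by (auto simp: Q_def)
    then obtain b t where b: "b \<in> carrier R" "t \<in> regular_elements R" "y = fraction R b t"
      by (rule total_fractions_cases)
    have eq: "x \<otimes>\<^bsub>G\<^esub> y = fraction R (a \<otimes> b) (s \<otimes> t)"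
      using a b by (simp add: Q_def mult_fraction)
    have "x \<otimes>\<^bsub>G\<^esub> y \<in> H" using xy(1,2) G.m_closed by simp
    then have "a \<otimes> b \<in> PIdl (W j)"
      using xy(3) a b mem_iff[OF j, of "a \<otimes> b" "s \<otimes> t"] unfolding eq by (simp add: regular_mult)
    then have "a \<in> PIdl (W j) \<or> b \<in> PIdl (W j)" using p.I_prime[OF a(1) b(1)] by simp
    then show "x \<in> cgenideal G (w j) \<or> y \<in> cgenideal G (w j)"
      using mem_iff[OF j a(1,2)] mem_iff[OF j b(1,2)] xy(1,2) unfolding a(3) b(3) G_simps by blast
  qed
qed

section \<open>Polynomials of the form \<open>y\<^sup>m - H(x)\<close>\<close>

lemma embed_poly_simps [simp]:
  "embed_poly 0 = 0" "embed_poly 1 = 1" "embed_poly (p + q) = embed_poly p + embed_poly q"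
  "embed_poly (p * q) = embed_poly p * embed_poly q" "embed_poly (- p) = - embed_poly p"
  "embed_poly p = 0 \<longleftrightarrow> p = 0"
  by (simp_all add: embed_poly_def)

interpretation embed_poly: inj_idom_hom embed_poly
  by unfold_locales (simp_all add: embed_poly_def)

interpretation map_embed_poly: map_poly_inj_idom_hom embed_poly ..

lemmas map_embed_poly_simps =
  map_embed_poly.hom_add map_embed_poly.hom_mult map_embed_poly.hom_minus embed_poly.map_poly_hom_smult
  embed_poly.map_poly_pCons_hom

text \<open>
  A nonzero polynomial of least degree vanishing at \<open>Y\<close> divides \<open>y\<^sup>m - H\<close> up to a constant, so all
  its roots are \<open>m\<close>-th roots of \<open>H\<close>. The \<open>m\<close>-th power of its constant term is therefore, up to sign,
  an \<open>m\<close>-th power times a power of \<open>H\<close>, and comparing orders of vanishing bounds its degree.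
\<close>

lemma kummer_degree:
  fixes H :: "'c::field poly" and r :: "'c poly poly"
  assumes m: "m > 0" and H: "H \<noteq> 0" and Y: "Y ^ m = embed_poly H"
    and orders: "\<And>j. (\<And>b. m dvd j * Polynomial.order b H) \<Longrightarrow> m dvd j"
    and r: "r \<noteq> 0" "poly (map_poly embed_poly r) Y = 0"
  shows "m \<le> Polynomial.degree r"
proof (rule ccontr)
  assume small: "\<not> m \<le> Polynomial.degree r"
  let ?ev = "\<lambda>q. poly (map_poly embed_poly q) Y"
  let ?P = "monom 1 m - [:H:] :: 'c poly poly"
  obtain q where q: "q \<noteq> 0" "?ev q = 0" "Polynomial.degree q \<le> Polynomial.degree r"
    and minimal: "\<And>q'. q' \<noteq> 0 \<Longrightarrow> ?ev q' = 0 \<Longrightarrow> Polynomial.degree q \<le> Polynomial.degree q'"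
    using ex_has_least_nat[of "\<lambda>q. q \<noteq> 0 \<and> ?ev q = 0" r degree] r by blast
  have evP: "?ev ?P = 0"
    using Y by (simp add: map_embed_poly_simps poly_monom)
  have deg_pos: "Polynomial.degree q > 0"
  proof (rule ccontr)
    assume "\<not> Polynomial.degree q > 0"
    then obtain a where "q = [:a:]" by (auto elim: degree_eq_zeroE)
    then show False using q by simp
  qed
  \<comment> \<open>The coefficients are polynomials and \<open>q\<close> need not be monic, so
    \<open>?P\<close> has to be multiplied by a power \<open>k\<close> of the leading coefficient
    before dividing. The remainder vanishes at \<open>Y\<close> and is zero by minimality of
    \<open>q\<close>.\<close>
  obtain s t where st: "pseudo_divmod ?P q = (s, t)" by fastforce
  define k where "k = Polynomial.lead_coeff q ^ (Suc (Polynomial.degree ?P) - Polynomial.degree q)"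
  have div: "smult k ?P = q * s + t" and t: "t = 0 \<or> Polynomial.degree t < Polynomial.degree q"
    using pseudo_divmod[OF q(1) st] by (simp_all add: k_def)
  have k0: "k \<noteq> 0" using q(1) by (simp add: k_def)
  have "?ev (smult k ?P) = ?ev q * ?ev s + ?ev t"
    unfolding div by (simp add: map_embed_poly_simps)
  then have "?ev t = 0" using evP q(2) by (simp add: map_embed_poly_simps)
  then have "t = 0" using minimal[of t] t by force
  let ?q = "map_poly embed_poly q"
  have root: "\<alpha> ^ m = embed_poly H" if "poly ?q \<alpha> = 0" for \<alpha>
  proof -
    have "poly (map_poly embed_poly (smult k ?P)) \<alpha> = 0"
      unfolding div \<open>t = 0\<close> using that by (simp add: map_embed_poly_simps)
    then show ?thesis
      using k0 by (simp add: map_embed_poly_simps poly_monom)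
  qed
  obtain A where A: "size A = Polynomial.degree ?q" "?q = smult (Polynomial.lead_coeff ?q) (\<Prod>x\<in>#A. [:- x, 1:])"
    using alg_closed_imp_factorization[of ?q] q(1) by auto
  have poly_q: "poly ?q \<alpha> = Polynomial.lead_coeff ?q * poly (\<Prod>x\<in>#A. [:- x, 1:]) \<alpha>" for \<alpha>
    using arg_cong[OF A(2), of "\<lambda>p. poly p \<alpha>"] by (simp only: poly_smult)
  have "\<alpha> ^ m = embed_poly H" if "\<alpha> \<in># A" for \<alpha>
  proof (rule root)
    have "[:- \<alpha>, 1:] dvd (\<Prod>x\<in>#A. [:- x, 1:])"
      using that by (intro dvd_prod_mset) auto
    then have "poly (\<Prod>x\<in>#A. [:- x, 1:]) \<alpha> = 0" by (simp add: poly_eq_0_iff_dvd)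
    then show "poly ?q \<alpha> = 0" unfolding poly_q by simp
  qed
  \<comment> \<open>The product of the \<open>- x\<close> is the constant term of \<open>?q\<close>
    divided by its leading coefficient. The sign is kept next to \<open>H\<close>, where it does not
    affect orders of vanishing.\<close>
  then have "(\<Prod>x\<in>#A. - x) ^ m = ((- 1) ^ m * embed_poly H) ^ size A"
  proof (induction A)
    case (add x A)
    then have "(- x) ^ m = (- 1) ^ m * embed_poly H" using power_minus[of x m] by simp
    with add show ?case by (simp add: power_mult_distrib del: mult_minus_left)
  qed simp
  moreover have "poly (\<Prod>x\<in>#A. [:- x, 1:]) 0 = (\<Prod>x\<in>#A. - x)"
    by (induction A) simp_all
  moreover have "poly ?q 0 = embed_poly (Polynomial.coeff q 0)"
    by (simp add: poly_0_coeff_0)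
  moreover note poly_q[of 0]
  ultimately have "embed_poly (Polynomial.coeff q 0) ^ m
      = embed_poly (Polynomial.lead_coeff q) ^ m * ((- 1) ^ m * embed_poly H) ^ Polynomial.degree q"
    by (simp add: power_mult_distrib A(1))
  then have "embed_poly (Polynomial.coeff q 0 ^ m)
      = embed_poly (Polynomial.lead_coeff q ^ m * ((- 1) ^ m * H) ^ Polynomial.degree q)"
    by (simp add: embed_poly.hom_power embed_poly.hom_mult embed_poly.hom_uminus)
  then have eq: "Polynomial.coeff q 0 ^ m = Polynomial.lead_coeff q ^ m * ((- 1) ^ m * H) ^ Polynomial.degree q"
    by (simp only: embed_poly.eq_iff)
  moreover have "Polynomial.lead_coeff q ^ m * ((- 1) ^ m * H) ^ Polynomial.degree q \<noteq> 0"
    using q(1) H by simp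
  ultimately have q0: "Polynomial.coeff q 0 \<noteq> 0" using m by (metis power_eq_0_iff)
  \<comment> \<open>In \<open>eq\<close> the two coefficients of \<open>q\<close> enter as
    \<open>m\<close>-th powers, so the remaining term, the degree of \<open>q\<close> times the
    order of \<open>H\<close>, is a multiple of \<open>m\<close> at every point.\<close>
  have "m dvd Polynomial.degree q * Polynomial.order b H" for b
  proof -
    have pow: "Polynomial.order b (p ^ i) = i * Polynomial.order b p" if "p \<noteq> 0" for i and p :: "'c poly"
      using that by (induction i) (simp_all add: order_mult)
    have sgn: "Polynomial.order b ((- 1) ^ m * H) = Polynomial.order b H"
      by (cases "even m") simp_all
    have "m * Polynomial.order b (Polynomial.coeff q 0) = Polynomial.order b (Polynomial.coeff q 0 ^ m)"
      using q0 by (simp add: pow)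
    also have "\<dots> = m * Polynomial.order b (Polynomial.lead_coeff q) + Polynomial.degree q * Polynomial.order b H"
      unfolding eq using q(1) H by (simp add: order_mult pow sgn)
    finally show ?thesis by (metis dvd_add_right_iff dvd_triv_left)
  qed
  then have "m dvd Polynomial.degree q" by (rule orders)
  with deg_pos q(3) small show False using dvd_imp_le[of m "Polynomial.degree q"] by simp
qed

lemma monic_binomial:
  fixes H :: "'a::comm_ring_1"
  assumes "m > 0"
  shows "Polynomial.degree (monom 1 m - [:H:]) = m" "Polynomial.lead_coeff (monom 1 m - [:H:]) = 1"
proof -
  have "Polynomial.degree (monom 1 m - [:H:]) = Polynomial.degree (monom (1::'a) m)"
    unfolding diff_conv_add_uminus
    by (rule degree_add_eq_left) (use assms in \<open>simp add: degree_monom_eq\<close>)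
  then show *: "Polynomial.degree (monom 1 m - [:H:]) = m" by (simp add: degree_monom_eq)
  show "Polynomial.lead_coeff (monom 1 m - [:H:]) = 1"
    unfolding * using assms by (cases m) simp_all
qed

lemma divide_by_monic:
  fixes P q :: "'a::idom poly"
  assumes "Polynomial.lead_coeff P = 1"
  obtains s t where "q = P * s + t" "t = 0 \<or> Polynomial.degree t < Polynomial.degree P"
proof -
  have P0: "P \<noteq> 0" using assms by auto
  obtain s t where st: "pseudo_divmod q P = (s, t)" by fastforce
  show ?thesis
    using that[of s t] pseudo_divmod[OF P0 st] assms by simp
qed

text \<open>The multiples of \<open>?P\<close> are the kernel of evaluation at an
  \<open>m\<close>-th root \<open>Y\<close> of \<open>H\<close>, a homomorphism into a field: after
  division by the monic \<open>?P\<close> the remainder has degree less than \<open>m\<close>, and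
  by \<open>kummer_degree\<close> it can vanish at \<open>Y\<close> only if it is zero.\<close>

lemma kummer_prime:
  fixes H :: "'c::field poly" and a b :: "'c poly poly"
  assumes m: "m > 0" and H: "H \<noteq> 0"
    and orders: "\<And>j. (\<And>b. m dvd j * Polynomial.order b H) \<Longrightarrow> m dvd j"
    and dvd: "monom 1 m - [:H:] dvd a * b"
  shows "monom 1 m - [:H:] dvd a \<or> monom 1 m - [:H:] dvd b"
proof -
  let ?P = "monom 1 m - [:H:] :: 'c poly poly"
  obtain Y where Y: "Y ^ m = embed_poly H"
    using nth_root_exists[of m "embed_poly H"] m by auto
  let ?ev = "\<lambda>q. poly (map_poly embed_poly q) Y"
  have evP: "?ev ?P = 0"
    using Y by (simp add: map_embed_poly_simps poly_monom)
  have ker: "?P dvd q" if "?ev q = 0" for q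
  proof -
    obtain s t where st: "q = ?P * s + t" "t = 0 \<or> Polynomial.degree t < Polynomial.degree ?P"
      using divide_by_monic monic_binomial(2)[OF m] by metis
    have "?ev t = 0"
      using that evP unfolding st(1) by (simp add: map_embed_poly_simps)
    then have "t = 0"
      using kummer_degree[OF m H Y orders, of t] st(2) monic_binomial(1)[OF m, of H] by force
    then show ?thesis by (simp add: st(1))
  qed
  obtain s where "a * b = ?P * s" using dvd by (elim dvdE)
  then have "?ev (a * b) = ?ev ?P * ?ev s" by (simp add: map_embed_poly_simps)
  then have "?ev a * ?ev b = 0" using evP by (simp add: map_embed_poly_simps)
  then show ?thesis using ker by auto
qed

text \<open>As polynomials in \<open>x\<close> both sides are monic of degree \<open>d\<close> and
  agree at the \<open>d\<close> points \<open>z ^ j * y\<close>. These are distinct only for nonzero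
  \<open>y\<close>, hence the case distinction.\<close>

lemma prod_roots_of_unity:
  fixes x y z :: "'a::idom"
  assumes d: "d > 0" and z: "z ^ d = 1" and inj: "inj_on (\<lambda>j. z ^ j) {..<d}"
  shows "(\<Prod>j<d. x - z ^ j * y) = x ^ d - y ^ d"
proof (cases "y = 0")
  case True
  then show ?thesis using d by simp
next
  case False
  let ?p = "(\<Prod>j<d. [:- (z ^ j * y), 1:])"
  let ?q = "monom 1 d - [:y ^ d:]"
  have deg_p: "Polynomial.degree ?p = d" by (subst degree_prod_eq_sum_degree) simp_all
  have "?p = ?q"
  proof (rule poly_eqI_degree_lead_coeff)
    have "Polynomial.lead_coeff ?p = 1" by (simp add: lead_coeff_prod)
    then show "poly.coeff ?p d = poly.coeff ?q d"
      using monic_binomial[OF d, of "y ^ d"] by (simp add: deg_p)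
    show "d \<le> card ((\<lambda>j. z ^ j * y) ` {..<d})"
      using inj False by (subst card_image) (auto simp: inj_on_def)
    show "Polynomial.degree ?p \<le> d" "Polynomial.degree ?q \<le> d"
      using deg_p monic_binomial(1)[OF d, of "y ^ d"] by simp_all
    fix x assume "x \<in> (\<lambda>j. z ^ j * y) ` {..<d}"
    then obtain j where j: "j < d" "x = z ^ j * y" by auto
    have "(z ^ j) ^ d = 1" using z by (metis mult.commute power_mult power_one)
    then have "x ^ d = y ^ d" by (simp add: j(2) power_mult_distrib)
    moreover have "poly ?p x = 0"
      using j by (auto simp: poly_prod)
    ultimately show "poly ?p x = poly ?q x"
      by (simp add: poly_monom)
  qed
  then have "poly ?p x = poly ?q x" by simp
  then show ?thesis by (simp add: poly_prod poly_monom)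
qed

section \<open>The coordinate ring of a superelliptic curve\<close>

lemma ring_of_type_algebra_simps [simp]:
  "carrier ring_of_type_algebra = UNIV" "x \<otimes>\<^bsub>ring_of_type_algebra\<^esub> y = x * y"
  "x \<oplus>\<^bsub>ring_of_type_algebra\<^esub> y = x + y" "\<one>\<^bsub>ring_of_type_algebra\<^esub> = 1"
  "\<zero>\<^bsub>ring_of_type_algebra\<^esub> = 0"
  by (simp_all add: ring_of_type_algebra_def)

locale superelliptic_ring =
  fixes n :: nat and g :: "'k::field poly"
  assumes n_pos: "n > 0"
begin

abbreviation "A \<equiv> curve_ring n g"
abbreviation "cls \<equiv> curve_class n g"
abbreviation "P \<equiv> monom 1 n - [:map_poly to_ac g:] :: 'k alg_closure poly poly"

sublocale type_ring: cring "ring_of_type_algebra :: 'k alg_closure poly poly ring"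
  by (rule cring_from_type_algebra)

lemma ideal_curve: "ideal (curve_ideal n g) ring_of_type_algebra"
  unfolding curve_ideal_def by (rule type_ring.cgenideal_ideal) simp

sublocale cring A
  unfolding curve_ring_def
  by (rule ideal.quotient_is_cring[OF ideal_curve cring_from_type_algebra])

lemma cls_hom: "cls \<in> Ring.ring_hom ring_of_type_algebra A"
  using ideal.rcos_ring_hom[OF ideal_curve]
  by (simp add: curve_ring_def curve_class_def[abs_def])

lemma cls_closed [simp]: "cls q \<in> carrier A"
  using ring_hom_closed[OF cls_hom] by simp

lemma cls_mult: "cls (p * q) = cls p \<otimes>\<^bsub>A\<^esub> cls q"
  using ring_hom_mult[OF cls_hom, of p q] by simp

lemma cls_add: "cls (p + q) = cls p \<oplus>\<^bsub>A\<^esub> cls q"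
  using ring_hom_add[OF cls_hom, of p q] by simp

lemma cls_one: "cls 1 = \<one>\<^bsub>A\<^esub>"
  using ring_hom_one[OF cls_hom] by simp

lemma cls_zero: "cls 0 = \<zero>\<^bsub>A\<^esub>"
proof -
  have "cls 0 \<oplus>\<^bsub>A\<^esub> cls 0 = cls 0" by (simp flip: cls_add)
  then show ?thesis using add.l_cancel_one[of "cls 0" "cls 0"] by simp
qed

lemma cls_power: "cls (p ^ i) = cls p [^]\<^bsub>A\<^esub> (i::nat)"
  by (induction i) (simp_all add: cls_one cls_mult m_comm)

lemma cls_cases:
  assumes "x \<in> carrier A"
  obtains q where "x = cls q"
  using assms unfolding curve_ring_def curve_class_def FactRing_def A_RCOSETS_def' by auto

lemma cls_prod:
  assumes "finite J"
  shows "cls (\<Prod>j\<in>J. f j) = finprod A (\<lambda>j. cls (f j)) J"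
  using assms by (induction J rule: finite_induct) (simp_all add: cls_one cls_mult)

lemma cls_eq_zero_iff: "cls q = \<zero>\<^bsub>A\<^esub> \<longleftrightarrow> P dvd q"
proof -
  interpret I: ideal "curve_ideal n g" "ring_of_type_algebra" by (rule ideal_curve)
  have "\<zero>\<^bsub>A\<^esub> = curve_ideal n g"
    by (simp add: curve_ring_def FactRing_def)
  then have "cls q = \<zero>\<^bsub>A\<^esub> \<longleftrightarrow> q \<in> curve_ideal n g"
    unfolding curve_class_def
    using type_ring.a_rcos_zero[OF ideal_curve, of q] I.rcos_const_imp_mem[of q] by auto
  also have "\<dots> \<longleftrightarrow> (\<exists>x. q = x * P)"
    by (simp add: curve_ideal_def cgenideal_def)
  also have "\<dots> \<longleftrightarrow> P dvd q"
    unfolding dvd_def by (simp only: mult.commute)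
  finally show ?thesis .
qed

lemma cls_minus: "cls (p - q) \<oplus>\<^bsub>A\<^esub> cls q = cls p"
  by (simp flip: cls_add)

lemma cls_eq_iff: "cls p = cls q \<longleftrightarrow> P dvd p - q"
proof
  assume "cls p = cls q"
  then have "cls (p - q) \<oplus>\<^bsub>A\<^esub> cls q = cls q" using cls_minus[of p q] by simp
  then have "cls (p - q) = \<zero>\<^bsub>A\<^esub>" using add.r_cancel_one[of "cls q" "cls (p - q)"] by simp
  then show "P dvd p - q" by (simp add: cls_eq_zero_iff)
next
  assume "P dvd p - q"
  then have "cls (p - q) = \<zero>\<^bsub>A\<^esub>" by (simp add: cls_eq_zero_iff)
  then show "cls p = cls q" using cls_minus[of p q] by simp
qed

text \<open>Representatives differ by multiples of \<open>P\<close>, and these are multiples of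
  \<open>w\<close> by assumption; so divisibility by \<open>w\<close> does not depend on the
  representative.\<close>

lemma cls_mem_cgenideal:
  assumes "w dvd P"
  shows "cls q \<in> cgenideal A (cls w) \<longleftrightarrow> w dvd q"
proof
  assume "cls q \<in> cgenideal A (cls w)"
  then obtain s where "cls q = cls s \<otimes>\<^bsub>A\<^esub> cls w"
    unfolding cgenideal_def by (auto elim: cls_cases)
  then have "P dvd q - s * w" by (simp add: cls_eq_iff flip: cls_mult)
  then have "w dvd q - s * w" using assms by (rule dvd_trans[rotated])
  then have "w dvd (q - s * w) + s * w" by (intro dvd_add) simp_all
  then show "w dvd q" by simp
next
  assume "w dvd q"
  then obtain s where "q = w * s" by (elim dvdE)
  then have "q = s * w" by (simp only: mult.commute)
  then show "cls q \<in> cgenideal A (cls w)"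
    unfolding cgenideal_def by (auto simp: cls_mult)
qed

lemma cls_primeideal:
  assumes w: "w dvd P" and nonunit: "\<not> w dvd 1"
    and prime: "\<And>a b. w dvd a * b \<Longrightarrow> w dvd a \<or> w dvd b"
  shows "primeideal (cgenideal A (cls w)) A"
proof (rule primeidealI)
  show "ideal (cgenideal A (cls w)) A" by (rule cgenideal_ideal) simp
  show "cring A" by (rule is_cring)
  have "cls 1 \<notin> cgenideal A (cls w)" using nonunit by (simp add: cls_mem_cgenideal[OF w])
  then show "carrier A \<noteq> cgenideal A (cls w)" using cls_closed by metis
  fix x y assume "x \<in> carrier A" "y \<in> carrier A" "x \<otimes>\<^bsub>A\<^esub> y \<in> cgenideal A (cls w)"
  then obtain a b where "x = cls a" "y = cls b" "cls (a * b) \<in> cgenideal A (cls w)"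
    by (metis cls_cases cls_mult)
  then show "x \<in> cgenideal A (cls w) \<or> y \<in> cgenideal A (cls w)"
    using prime by (simp add: cls_mem_cgenideal[OF w])
qed

text \<open>\<open>P\<close> is monic in \<open>y\<close>, so \<open>A\<close> is a free module over
  the polynomials in \<open>x\<close>. Multiplying the remainder \<open>t\<close> by
  \<open>h\<close> keeps its degree in \<open>y\<close> below \<open>n\<close>, so the product can
  be a multiple of \<open>P\<close> only if it is zero.\<close>

lemma cls_regular:
  assumes "h \<noteq> 0"
  shows "cls [:h:] \<in> regular_elements A"
  unfolding regular_elements_def
proof (intro CollectI conjI ballI impI)
  fix x assume "x \<in> carrier A" "cls [:h:] \<otimes>\<^bsub>A\<^esub> x = \<zero>\<^bsub>A\<^esub>"
  then obtain q where q: "x = cls q" "P dvd [:h:] * q"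
    by (metis cls_cases cls_mult cls_eq_zero_iff)
  obtain s t where st: "q = P * s + t" "t = 0 \<or> Polynomial.degree t < Polynomial.degree P"
    using divide_by_monic monic_binomial(2)[OF n_pos] by metis
  have "P dvd [:h:] * q - P * (s * [:h:])"
    using dvd_diff[OF q(2) dvd_triv_left] .
  also have "[:h:] * q - P * (s * [:h:]) = smult h t"
    by (simp add: st(1) algebra_simps smult_add_right)
  finally have "P dvd smult h t" .
  then have "smult h t = 0"
    using st(2) assms dvd_imp_degree_le[of P "smult h t"] by fastforce
  then show "x = \<zero>\<^bsub>A\<^esub>"
    using assms by (simp add: q st(1) cls_eq_zero_iff)
qed simp

lemma curve_form_cls: "cls (map_poly (map_poly to_ac) q) \<in> curve_form n g"
  by (simp add: curve_form_def)

lemma curve_form_carrier: "curve_form n g \<subseteq> carrier A"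
  by (auto simp: curve_form_def)

text \<open>The bivariate polynomials over the closed field are generated by its constants together
  with \<open>x\<close> and \<open>y\<close>, whose classes already belong to the form over the
  ground field.\<close>

lemma base_change_closed_field:
  "base_change A (curve_const n g) (curve_form n g) UNIV = carrier A" (is "?B = _")
proof
  have gen: "range (curve_const n g) \<union> curve_form n g \<subseteq> carrier A"
    using curve_form_carrier by (auto simp: curve_const_def)
  then show "?B \<subseteq> carrier A"
    unfolding base_change_def by (rule generate_ring_incl)
  have const: "cls [:[:c:]:] \<in> ?B" for c
    unfolding base_change_def by (intro generate_ring.incl) (auto simp: curve_const_def)
  have form: "cls (map_poly (map_poly to_ac) q) \<in> ?B" for q
    unfolding base_change_def using curve_form_cls by (intro generate_ring.incl) auto
  have add: "x \<in> ?B \<Longrightarrow> y \<in> ?B \<Longrightarrow> x \<oplus>\<^bsub>A\<^esub> y \<in> ?B"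
    and mult: "x \<in> ?B \<Longrightarrow> y \<in> ?B \<Longrightarrow> x \<otimes>\<^bsub>A\<^esub> y \<in> ?B" for x y
    unfolding base_change_def by (auto intro: generate_ring.intros)
  have zero: "cls 0 \<in> ?B" using const[of 0] by simp
  have "cls [:[:0, 1:]:] \<in> ?B" "cls [:0, 1:] \<in> ?B"
    using form[of "[:[:0, 1:]:]"] form[of "[:0, 1:]"] by (simp_all add: map_poly_pCons)
  then have poly_x: "cls [:p:] \<in> ?B" for p
  proof (induction p)
    case (pCons a p)
    have "[:pCons a p:] = [:[:a:]:] + [:[:0, 1:]:] * [:p:]" by simp
    then show ?case using pCons const add mult by (metis cls_add cls_mult)
  qed (use zero in simp)
  have "cls q \<in> ?B" for q
  proof (induction q)
    case (pCons a q)
    have "pCons a q = [:a:] + [:0, 1:] * q" by simp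
    then show ?case using pCons poly_x add mult \<open>cls [:0, 1:] \<in> ?B\<close> by (metis cls_add cls_mult)
  qed (rule zero)
  then show "carrier A \<subseteq> ?B" by (auto elim: cls_cases)
qed

lemma geometric_ring_curve:
  "geometric_ring A (curve_const n g) (curve_form n g) = A"
  by (simp add: geometric_ring_def base_change_closed_field)

lemma curve_frac_hom: "curve_frac n g \<in> Ring.ring_hom A (total_fractions A)"
  by (rule ring_hom_memI)
    (simp_all add: curve_frac_def fraction_carrier one_regular mult_fraction add_fraction
      one_total_fractions)

end

section \<open>Curves whose equation is a power\<close>

interpretation to_ac_hom: inj_idom_hom to_ac
  by unfold_locales simp_all

interpretation map_to_ac_hom: map_poly_inj_idom_hom to_ac ..

text \<open>The shape that the reduced curve will have, \<open>y^n = c h^d\<close>. The condition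
  \<open>orders\<close> expresses that \<open>m\<close> and the orders of vanishing of
  \<open>h\<close> have no common divisor, in the form in which \<open>kummer_degree\<close> uses it
  with \<open>j\<close> the degree of a polynomial. \<open>M\<close> stands for the field of
  definition; it is only asked to contain the constants that occur in the factors.\<close>

locale split_superelliptic =
  fixes n d m :: nat and g h :: "'k::field poly" and c :: 'k
    and \<gamma> z :: "'k alg_closure" and M :: "'k alg_closure set"
  assumes n_eq: "n = d * m" and d_pos: "d > 0" and m_pos: "m > 0"
    and g_eq: "g = smult c (h ^ d)" and h_nz: "h \<noteq> 0" and c_nz: "c \<noteq> 0"
    and \<gamma>: "\<gamma> ^ d = to_ac c"
    and z: "z ^ d = 1" and z_inj: "inj_on (\<lambda>j. z ^ j) {..<d}"
    and orders: "\<And>j. (\<And>b. m dvd j * Polynomial.order b (map_poly to_ac h)) \<Longrightarrow> m dvd j"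
    and M: "\<And>j. j < d \<Longrightarrow> - (z ^ j * \<gamma>) \<in> M"
begin

sublocale superelliptic_ring n g
  by unfold_locales (simp add: n_eq d_pos m_pos)

abbreviation "hb \<equiv> map_poly to_ac h"

definition branch_poly :: "nat \<Rightarrow> 'k alg_closure poly poly" where
  "branch_poly j = Polynomial.monom 1 m - [:smult (z ^ j * \<gamma>) hb:]"

lemma hb_nz: "hb \<noteq> 0"
  using h_nz by simp

lemma root_nz: "z ^ j * \<gamma> \<noteq> 0"
  using \<gamma> c_nz z d_pos by (auto simp: power_0_left)

text \<open>This is \<open>prod_roots_of_unity\<close> for \<open>y^m\<close> and
  \<open>\<gamma> h\<close>, with \<open>z\<close> regarded as a constant bivariate
  polynomial.\<close>

lemma prod_branch: "(\<Prod>j<d. branch_poly j) = P"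
proof -
  have "inj_on (\<lambda>j. [:[:z:]:] ^ j) {..<d}"
    using z_inj by (auto simp: inj_on_def poly_const_pow)
  then have "(\<Prod>j<d. Polynomial.monom 1 m - [:[:z:]:] ^ j * [:smult \<gamma> hb:])
      = Polynomial.monom 1 m ^ d - [:smult \<gamma> hb:] ^ d"
    using z d_pos by (intro prod_roots_of_unity) (simp_all add: poly_const_pow one_pCons)
  moreover have "[:[:z:]:] ^ j * [:smult \<gamma> hb:] = [:smult (z ^ j * \<gamma>) hb:]" for j
    by (simp add: poly_const_pow)
  moreover have "Polynomial.monom 1 m ^ d = (Polynomial.monom 1 n :: 'k alg_closure poly poly)"
    by (simp add: monom_power n_eq mult.commute)
  moreover have "[:smult \<gamma> hb:] ^ d = [:map_poly to_ac g:]"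
    by (simp add: poly_const_pow smult_power \<gamma> g_eq to_ac_hom.map_poly_hom_smult
        map_to_ac_hom.hom_power)
  ultimately show ?thesis by (simp add: branch_poly_def)
qed

lemma branch_dvd: "j < d \<Longrightarrow> branch_poly j dvd P"
  unfolding prod_branch[symmetric] by (rule dvd_prodI) simp_all

lemma branch_degree: "Polynomial.degree (branch_poly j) = m"
  unfolding branch_poly_def by (rule monic_binomial(1)[OF m_pos])

lemma branch_prime:
  assumes "j < d"
  shows "primeideal (cgenideal A (cls (branch_poly j))) A"
proof (rule cls_primeideal[OF branch_dvd[OF assms]])
  show "\<not> branch_poly j dvd 1"
    using dvd_imp_degree_le[of "branch_poly j" 1] branch_degree[of j] m_pos by auto
  show "branch_poly j dvd a \<or> branch_poly j dvd b" if "branch_poly j dvd a * b" for a b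
    using that unfolding branch_poly_def
  proof (elim kummer_prime[OF m_pos, rotated 2])
    show "smult (z ^ j * \<gamma>) hb \<noteq> 0" using root_nz hb_nz by simp
    show "m dvd i" if "\<And>b. m dvd i * Polynomial.order b (smult (z ^ j * \<gamma>) hb)" for i
      using that unfolding order_smult[OF root_nz] by (rule orders)
  qed
qed

text \<open>Two factors differ by a polynomial of degree 0 in \<open>y\<close>. A factor has degree
  \<open>m > 0\<close> in \<open>y\<close> and can divide this difference only if it is
  zero.\<close>

lemma branch_incomparable:
  assumes "i < d" "j < d" "cls (branch_poly i) \<in> cgenideal A (cls (branch_poly j))"
  shows "i = j"
proof -
  have "branch_poly j dvd branch_poly i"
    using assms(3) by (simp add: cls_mem_cgenideal[OF branch_dvd[OF assms(2)]])
  then have "branch_poly j dvd branch_poly i - branch_poly j" by (intro dvd_diff) simp_all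
  moreover have diff: "branch_poly i - branch_poly j = [:smult (z ^ j * \<gamma> - z ^ i * \<gamma>) hb:]"
    by (simp add: branch_poly_def smult_diff_left)
  ultimately have "smult (z ^ j * \<gamma> - z ^ i * \<gamma>) hb = 0"
    using dvd_imp_degree_le[of "branch_poly j" "branch_poly i - branch_poly j"] branch_degree[of j] m_pos
    by (cases "branch_poly i - branch_poly j = 0") auto
  then have "z ^ i = z ^ j" using hb_nz root_nz[of 0] by simp
  then show "i = j" using z_inj assms by (auto simp: inj_on_def)
qed

lemma cls_prod_branch: "finprod A (\<lambda>j. cls (branch_poly j)) {..<d} = \<zero>\<^bsub>A\<^esub>"
  by (simp flip: cls_prod add: prod_branch cls_eq_zero_iff)

text \<open>Separates the constant \<open>- (z ^ j * \<gamma>)\<close> from \<open>y^m\<close> and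
  \<open>h\<close>, which have coefficients in the ground field. So the factor lies in the
  coordinate ring over \<open>M\<close>.\<close>

lemma cls_branch:
  "cls (branch_poly j) = cls (Polynomial.monom 1 m) \<oplus>\<^bsub>A\<^esub> cls [:[:- (z ^ j * \<gamma>):]:] \<otimes>\<^bsub>A\<^esub> cls [:hb:]"
proof -
  have "branch_poly j = Polynomial.monom 1 m + [:[:- (z ^ j * \<gamma>):]:] * [:hb:]"
    unfolding branch_poly_def diff_conv_add_uminus by simp
  then show ?thesis by (simp only: cls_mult cls_add)
qed

lemma monom_in_form: "cls (Polynomial.monom 1 m) \<in> curve_form n g"
  using curve_form_cls[of "Polynomial.monom 1 m"] by (simp add: map_poly_monom)

lemma hb_in_form: "cls [:hb:] \<in> curve_form n g"
proof -
  have "map_poly (map_poly to_ac) [:h:] = [:hb:]" by (simp add: map_to_ac_hom.map_poly_pCons_hom)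
  then show ?thesis using curve_form_cls[of "[:h:]"] by metis
qed

theorem curve_components: "curve_components_over n g d M"
  unfolding curve_components_over_def
proof (rule has_components_over_principal[where w = "\<lambda>j. cls (branch_poly j)"];
    (unfold geometric_ring_curve)?)
  show "cls (branch_poly j) \<in> base_change A (curve_const n g) (curve_form n g) M" if "j < d" for j
    unfolding cls_branch base_change_def using M[OF that] monom_in_form hb_in_form
    by (auto intro!: generate_ring.eng_add generate_ring.eng_mult intro: generate_ring.incl
        simp flip: curve_const_def)
qed (use branch_prime branch_incomparable cls_prod_branch is_cring in auto)

section \<open>The normalization of the curve\<close>

abbreviation "Q \<equiv> total_fractions A"
abbreviation "cfrac \<equiv> curve_frac n g"
abbreviation "normal_form \<equiv> normalization_in Q (cfrac ` curve_form n g)"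

sublocale Q: cring Q
  by (rule cring_total_fractions)

lemma frac_closed: "x \<in> carrier A \<Longrightarrow> cfrac x \<in> carrier Q"
  using ring_hom_closed[OF curve_frac_hom] .

lemma hb_regular: "cls [:hb:] \<in> regular_elements A"
  using cls_regular hb_nz by blast

lemma frac_form_closed: "cfrac ` curve_form n g \<subseteq> carrier Q"
  using frac_closed curve_form_carrier by auto

lemma frac_eq_zero: "x \<in> carrier A \<Longrightarrow> cfrac x = \<zero>\<^bsub>Q\<^esub> \<Longrightarrow> x = \<zero>\<^bsub>A\<^esub>"
  by (simp add: curve_frac_def zero_total_fractions fraction_eq_iff one_regular)

text \<open>Regularity in \<open>A\<close> passes to the form over \<open>k\<close>, a subring of
  it. This makes \<open>y^m / h\<close> a fraction of elements over \<open>k\<close>, as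
  \<open>normalization_in\<close> requires.\<close>

lemma frac_hb_regular:
  "cfrac (cls [:hb:]) \<in> regular_elements (Q\<lparr>carrier := cfrac ` curve_form n g\<rparr>)"
proof -
  have "b = \<zero>\<^bsub>Q\<^esub>"
    if b: "b \<in> cfrac ` curve_form n g" "cfrac (cls [:hb:]) \<otimes>\<^bsub>Q\<^esub> b = \<zero>\<^bsub>Q\<^esub>" for b
  proof -
    obtain x where x: "x \<in> carrier A" "b = cfrac x" using b(1) curve_form_carrier by auto
    have "cfrac (cls [:hb:] \<otimes>\<^bsub>A\<^esub> x) = \<zero>\<^bsub>Q\<^esub>"
      using b(2) x by (simp add: ring_hom_mult[OF curve_frac_hom])
    then have "cls [:hb:] \<otimes>\<^bsub>A\<^esub> x = \<zero>\<^bsub>A\<^esub>" using x(1) by (intro frac_eq_zero) simp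
    then have "x = \<zero>\<^bsub>A\<^esub>"
      using hb_regular x(1) unfolding regular_elements_def by blast
    then show ?thesis by (simp add: x(2) curve_frac_def zero_total_fractions)
  qed
  then show ?thesis using hb_in_form unfolding regular_elements_def by auto
qed

text \<open>
  The function \<open>y\<^sup>m / h\<close> is a \<open>d\<close>-th root of the constant \<open>c\<close>, hence integral: it belongs to the
  normalization over the ground field and separates the components.
\<close>

definition root_quotient :: "('k alg_closure poly poly set \<times> 'k alg_closure poly poly set) set" where
  "root_quotient = fraction A (cls (Polynomial.monom 1 m)) (cls [:hb:])"

lemma root_quotient_closed: "root_quotient \<in> carrier Q"
  unfolding root_quotient_def using hb_regular by (intro fraction_carrier) simp_all

lemma hb_root_quotient: "cfrac (cls [:hb:]) \<otimes>\<^bsub>Q\<^esub> root_quotient = cfrac (cls (Polynomial.monom 1 m))"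
  unfolding curve_frac_def root_quotient_def
  using hb_regular by (simp add: mult_fraction one_regular fraction_eq_iff m_comm)

lemma hb_pow_regular: "cls [:hb:] [^]\<^bsub>A\<^esub> (i::nat) \<in> regular_elements A"
  using hb_regular by (induction i) (simp_all add: one_regular regular_mult)

lemma fraction_power:
  "root_quotient [^]\<^bsub>Q\<^esub> (i::nat)
    = fraction A (cls (Polynomial.monom 1 m) [^]\<^bsub>A\<^esub> i) (cls [:hb:] [^]\<^bsub>A\<^esub> i)"
proof (induction i)
  case (Suc i)
  then show ?case
    using hb_regular hb_pow_regular by (simp add: root_quotient_def mult_fraction)
qed (simp add: one_total_fractions)

lemma root_quotient_power: "root_quotient [^]\<^bsub>Q\<^esub> d = cfrac (cls [:[:to_ac c:]:])"
proof -
  have "Polynomial.monom 1 m ^ d = (Polynomial.monom 1 n :: 'k alg_closure poly poly)"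
    by (simp add: monom_power n_eq mult.commute)
  moreover have "[:[:to_ac c:]:] * [:hb:] ^ d = [:map_poly to_ac g:]"
    by (simp add: poly_const_pow g_eq to_ac_hom.map_poly_hom_smult map_to_ac_hom.hom_power)
  ultimately have "cls (Polynomial.monom 1 m ^ d) = cls ([:[:to_ac c:]:] * [:hb:] ^ d)"
    by (simp add: cls_eq_iff)
  then show ?thesis
    unfolding fraction_power curve_frac_def
    using hb_pow_regular
    by (simp only: cls_power cls_mult) (simp add: fraction_eq_iff one_regular)
qed

lemma root_quotient_normal: "root_quotient \<in> normal_form"
proof -
  \<comment> \<open>The coefficients below the top of the integral equation
    \<open>T^d - c = 0\<close> of \<open>y^m / h\<close>.\<close>
  define k where "k i = (if i = 0 then cfrac (cls [:[:to_ac (- c):]:]) else cfrac (cls 0))" for i :: nat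
  have form: "cls [:[:to_ac b:]:] \<in> curve_form n g" for b
    using curve_form_cls[of "[:[:b:]:]"]
    by (simp add: to_ac_hom.map_poly_pCons_hom map_to_ac_hom.map_poly_pCons_hom)
  have k_form: "k i \<in> cfrac ` curve_form n g" for i
    using form[of "- c"] form[of 0] by (auto simp: k_def)
  have k_closed: "k i \<in> carrier Q" for i using k_form frac_form_closed by auto
  have "k i = \<zero>\<^bsub>Q\<^esub>" if "i \<noteq> 0" for i
    using that by (simp add: k_def cls_zero curve_frac_def zero_total_fractions)
  then have "(\<Oplus>\<^bsub>Q\<^esub>i\<in>{..<d}. k i \<otimes>\<^bsub>Q\<^esub> (root_quotient [^]\<^bsub>Q\<^esub> i))
      = (\<Oplus>\<^bsub>Q\<^esub>i\<in>{..<d}. if 0 = i then k i else \<zero>\<^bsub>Q\<^esub>)"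
    using k_closed root_quotient_closed by (intro Q.finsum_cong') auto
  also have "\<dots> = k 0"
    using d_pos k_closed by (intro Q.add.finprod_singleton) auto
  finally have "(root_quotient [^]\<^bsub>Q\<^esub> d)
      \<oplus>\<^bsub>Q\<^esub> (\<Oplus>\<^bsub>Q\<^esub>i\<in>{..<d}. k i \<otimes>\<^bsub>Q\<^esub> (root_quotient [^]\<^bsub>Q\<^esub> i))
      = cfrac (cls [:[:to_ac c:]:]) \<oplus>\<^bsub>Q\<^esub> cfrac (cls [:[:to_ac (- c):]:])"
    by (simp add: root_quotient_power k_def)
  also have "\<dots> = cfrac (cls ([:[:to_ac c:]:] + [:[:to_ac (- c):]:]))"
    by (simp only: cls_add ring_hom_add[OF curve_frac_hom] cls_closed)
  also have "\<dots> = \<zero>\<^bsub>Q\<^esub>" by (simp add: cls_zero curve_frac_def zero_total_fractions)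
  finally have "integral_over Q (cfrac ` curve_form n g) root_quotient"
    unfolding integral_over_def using k_form by blast
  then show ?thesis
    unfolding normalization_in_def
    using root_quotient_closed frac_hb_regular hb_root_quotient monom_in_form by blast
qed

text \<open>Every \<open>x\<close> is the fraction \<open>x / 1\<close> and satisfies a monic
  equation of degree 1. Its constant term is \<open>- x\<close>, which must be exhibited as an
  element of the form.\<close>

lemma form_normal: "cfrac ` curve_form n g \<subseteq> normal_form"
proof
  fix x assume x: "x \<in> cfrac ` curve_form n g"
  then obtain q where q: "x = cfrac (cls (map_poly (map_poly to_ac) q))"
    by (auto simp: curve_form_def)
  have closed: "x \<in> carrier Q" using x frac_form_closed by auto
  define y where "y = cfrac (cls (map_poly (map_poly to_ac) (- q)))"
  have y: "y \<in> cfrac ` curve_form n g" unfolding y_def using curve_form_cls by blast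
  have "map_poly (map_poly to_ac) q + map_poly (map_poly to_ac) (- q) = 0"
    by (rule poly_eqI) (simp add: coeff_map_poly map_to_ac_hom.hom_uminus)
  then have "x \<oplus>\<^bsub>Q\<^esub> y = cfrac (cls 0)"
    unfolding q y_def by (metis cls_add cls_closed ring_hom_add[OF curve_frac_hom])
  then have "x \<oplus>\<^bsub>Q\<^esub> y = \<zero>\<^bsub>Q\<^esub>"
    by (simp add: cls_zero curve_frac_def zero_total_fractions)
  moreover have "y \<in> carrier Q" using y frac_form_closed by blast
  ultimately have "x [^]\<^bsub>Q\<^esub> (1::nat) \<oplus>\<^bsub>Q\<^esub> (\<Oplus>\<^bsub>Q\<^esub>i\<in>{..<1::nat}. y \<otimes>\<^bsub>Q\<^esub> (x [^]\<^bsub>Q\<^esub> i)) = \<zero>\<^bsub>Q\<^esub>"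
    using closed by (simp add: lessThan_Suc)
  then have int: "integral_over Q (cfrac ` curve_form n g) x"
    unfolding integral_over_def using y by (intro exI[of _ "1::nat"] exI[of _ "\<lambda>_. y"]) auto
  have "map_poly (map_poly to_ac) (1 :: 'k poly poly) = 1"
    by (rule poly_eqI) (simp add: coeff_map_poly)
  then have "\<one>\<^bsub>Q\<^esub> \<in> cfrac ` curve_form n g"
    using curve_form_cls[of 1] by (simp add: cls_one ring_hom_one[OF curve_frac_hom, symmetric])
  then have "\<one>\<^bsub>Q\<^esub> \<in> regular_elements (Q\<lparr>carrier := cfrac ` curve_form n g\<rparr>)"
    using frac_form_closed unfolding regular_elements_def by (simp add: subset_iff)
  moreover have "\<one>\<^bsub>Q\<^esub> \<otimes>\<^bsub>Q\<^esub> x = x" using closed by simp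
  ultimately show "x \<in> normal_form"
    unfolding normalization_in_def using closed int x by blast
qed

theorem normalization_components: "normalization_components_over n g d M"
proof -
  let ?\<kappa> = "cfrac \<circ> curve_const n g"
  \<comment> \<open>The coordinate ring of the normalization after extension of constants. Of its
    elements, only the image of \<open>A\<close> and the \<open>w j\<close> are ever named.\<close>
  define H where "H = base_change Q ?\<kappa> normal_form UNIV"
  define w where "w j = fraction A (cls (branch_poly j)) (cls [:hb:])" for j
  have gen: "range ?\<kappa> \<union> normal_form \<subseteq> carrier Q"
    using frac_closed by (auto simp: curve_const_def normalization_in_def)
  have H: "subring H Q"
    unfolding H_def base_change_def by (rule Q.generate_ring_is_subring[OF gen])
  \<comment> \<open>A translate of \<open>y^m / h\<close> by the constant
    \<open>- (z ^ j * \<gamma>)\<close>: it therefore lies in \<open>H\<close>, and over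
    \<open>M\<close> as soon as that constant is in \<open>M\<close>.\<close>
  have w_eq: "w j = root_quotient \<oplus>\<^bsub>Q\<^esub> cfrac (cls [:[:- (z ^ j * \<gamma>):]:])" for j
    unfolding w_def root_quotient_def curve_frac_def cls_branch
    using hb_regular by (simp add: add_fraction one_regular)
  have w_mem: "w j \<in> base_change Q ?\<kappa> normal_form N" if "- (z ^ j * \<gamma>) \<in> N" for j N
    unfolding w_eq base_change_def using that root_quotient_normal
    by (intro generate_ring.eng_add generate_ring.incl) (auto simp: curve_const_def)
  \<comment> \<open>\<open>A\<close> is generated by the constants and the form over
    \<open>k\<close>, and the latter is contained in the normalization; so the claim is checked on
    generators.\<close>
  have frac_H: "cfrac x \<in> H" if "x \<in> carrier A" for x
  proof -
    have "x \<in> generate_ring A (range (curve_const n g) \<union> curve_form n g)"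
      using that base_change_closed_field by (simp add: base_change_def)
    moreover have "range (curve_const n g) \<union> curve_form n g \<subseteq> carrier A"
      using curve_form_carrier by (auto simp: curve_const_def)
    ultimately show ?thesis
    proof (induction rule: generate_ring.induct)
      case one
      then show ?case
        using ring_hom_one[OF curve_frac_hom] H subringE(3) by metis
    next
      case (incl x)
      then show ?case
        unfolding H_def base_change_def using form_normal
        by (intro generate_ring.incl) auto
    next
      case (a_inv x)
      have "x \<in> carrier A" using a_inv generate_ring_in_carrier by blast
      then have "cfrac (\<ominus>\<^bsub>A\<^esub> x) = \<ominus>\<^bsub>Q\<^esub> cfrac x"
        using ring_hom_cring.hom_a_inv[OF ring_hom_cring.intro[OF is_cring Q.is_cring
            ring_hom_cring_axioms.intro[OF curve_frac_hom]]] by simp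
      then show ?case using subringE(5)[OF H] a_inv by metis
    next
      case (eng_add x y)
      then have "x \<in> carrier A" "y \<in> carrier A" using generate_ring_in_carrier by blast+
      then show ?case
        using subringE(7)[OF H] eng_add ring_hom_add[OF curve_frac_hom] by metis
    next
      case (eng_mult x y)
      then have "x \<in> carrier A" "y \<in> carrier A" using generate_ring_in_carrier by blast+
      then show ?case
        using subringE(6)[OF H] eng_mult ring_hom_mult[OF curve_frac_hom] by metis
    qed
  qed
  \<comment> \<open>The factors differ by a nonzero constant times \<open>h\<close>, so after
    division by \<open>h\<close> they differ by a unit.\<close>
  have diff: "\<exists>k\<in>Units A. cls (branch_poly i) = k \<otimes>\<^bsub>A\<^esub> cls [:hb:] \<oplus>\<^bsub>A\<^esub> cls (branch_poly j)"
    if ij: "i < d" "j < d" "i \<noteq> j" for i j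
  proof -
    let ?a = "z ^ j * \<gamma> - z ^ i * \<gamma>"
    have "z ^ i \<noteq> z ^ j" using z_inj ij by (auto simp: inj_on_def)
    then have "?a \<noteq> 0" using root_nz[of 0] by simp
    then have "cls [:[:?a:]:] \<otimes>\<^bsub>A\<^esub> cls [:[:inverse ?a:]:] = \<one>\<^bsub>A\<^esub>"
      "cls [:[:inverse ?a:]:] \<otimes>\<^bsub>A\<^esub> cls [:[:?a:]:] = \<one>\<^bsub>A\<^esub>"
      by (simp_all flip: cls_mult cls_one add: one_pCons)
    then have "cls [:[:?a:]:] \<in> Units A"
      unfolding Units_def using cls_closed by blast
    moreover have "branch_poly i = [:[:?a:]:] * [:hb:] + branch_poly j"
      by (simp add: branch_poly_def smult_diff_left)
    then have "cls (branch_poly i) = cls [:[:?a:]:] \<otimes>\<^bsub>A\<^esub> cls [:hb:] \<oplus>\<^bsub>A\<^esub> cls (branch_poly j)"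
      by (simp only: cls_mult cls_add)
    ultimately show ?thesis by blast
  qed
  have G: "geometric_ring Q ?\<kappa> normal_form = Q\<lparr>carrier := H\<rparr>"
    by (simp add: geometric_ring_def H_def)
  have wH: "w j \<in> H" for j unfolding H_def by (rule w_mem) simp
  note primes = total_fractions_overring_primes[where W = "\<lambda>j. cls (branch_poly j)" and N = d
      and h = "cls [:hb:]" and H = H, folded w_def, OF H]
  show ?thesis
    unfolding normalization_components_over_def
  proof (rule has_components_over_principal[where w = w]; (unfold G)?)
    show "cring (Q\<lparr>carrier := H\<rparr>)"
      using Q.subcring_iff[OF subringE(1)[OF H]] Q.subcringI'[OF H] by simp
    show "w j \<in> base_change Q ?\<kappa> normal_form M" if "j < d" for j
      by (rule w_mem) (rule M[OF that])
    show "primeideal (cgenideal (Q\<lparr>carrier := H\<rparr>) (w j)) (Q\<lparr>carrier := H\<rparr>)" if "j < d" for j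
      by (rule primes(1)) (use that frac_H hb_regular branch_prime branch_incomparable cls_prod_branch
        wH diff in \<open>auto simp: curve_frac_def\<close>)
    show "i = j" if "i < d" "j < d" "w i \<in> cgenideal (Q\<lparr>carrier := H\<rparr>) (w j)" for i j
      by (rule primes(2)) (use that frac_H hb_regular branch_prime branch_incomparable cls_prod_branch
        wH diff in \<open>auto simp: curve_frac_def\<close>)
    show "finprod (Q\<lparr>carrier := H\<rparr>) w {..<d} = \<zero>\<^bsub>Q\<lparr>carrier := H\<rparr>\<^esub>"
      by (rule primes(3)) (use frac_H hb_regular branch_prime branch_incomparable cls_prod_branch
        wH diff in \<open>auto simp: curve_frac_def\<close>)
  qed
qed

end

section \<open>Separable split polynomials\<close>

lemma poly_eq_sum_lessThan:
  fixes p :: "'a::comm_semiring_1 poly"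
  assumes "p = 0 \<or> Polynomial.degree p < N"
  shows "poly p x = (\<Sum>k<N. Polynomial.coeff p k * x ^ k)"
proof (cases "p = 0")
  case False
  with assms have "{..Polynomial.degree p} \<subseteq> {..<N}" by auto
  then show ?thesis
    unfolding poly_altdef
    by (intro sum.mono_neutral_left) (auto intro: le_degree)
qed simp

text \<open>The vector of powers of a common root is in the kernel of the Sylvester matrix.\<close>

lemma resultant_common_root:
  fixes p q :: "'a::field poly"
  assumes p: "poly p x = 0" and q: "poly q x = 0"
    and N: "0 < Polynomial.degree p + Polynomial.degree q"
  shows "resultant p q = 0"
proof -
  define m where "m = Polynomial.degree p"
  define n where "n = Polynomial.degree q"
  let ?S = "sylvester_mat p q"
  define v where "v = vec (m + n) (\<lambda>j. x ^ (m + n - Suc j))"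
  \<comment> \<open>Both the power of the variable and the coefficient index are raised by one, as
    in the entries given by \<open>sylvester_index_mat2\<close>. Undoing this shift turns the row
    sum into the value at \<open>x\<close> of the \<open>i\<close>-th power of the variable times
    \<open>g\<close>.\<close>
  have shifted: "(\<Sum>j<m + n. Polynomial.coeff (Polynomial.monom 1 (Suc i) * g) (m + n - j) * x ^ (m + n - Suc j)) = 0"
    if "poly g x = 0" "Polynomial.degree g + i < m + n" for g i
  proof -
    let ?h = "Polynomial.monom 1 i * g"
    have "Polynomial.coeff (Polynomial.monom 1 (Suc i) * g) (m + n - j) = Polynomial.coeff ?h (m + n - Suc j)"
      if "j < m + n" for j
      using that by (auto simp: coeff_monom_mult)
    then have "(\<Sum>j<m + n. Polynomial.coeff (Polynomial.monom 1 (Suc i) * g) (m + n - j) * x ^ (m + n - Suc j))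
        = (\<Sum>j<m + n. Polynomial.coeff ?h (m + n - Suc j) * x ^ (m + n - Suc j))"
      by simp
    also have "\<dots> = (\<Sum>k<m + n. Polynomial.coeff ?h k * x ^ k)"
      by (rule sum.nat_diff_reindex)
    also have "\<dots> = poly ?h x"
    proof (rule poly_eq_sum_lessThan[symmetric])
      show "?h = 0 \<or> Polynomial.degree ?h < m + n"
        using that(2) degree_mult_le[of "Polynomial.monom 1 i" g] degree_monom_le[of "1::'a" i]
        by linarith
    qed
    finally show ?thesis using that(1) by simp
  qed
  have "?S *\<^sub>v v = 0\<^sub>v (m + n)"
  proof (rule eq_vecI)
    fix i assume i: "i < dim_vec (0\<^sub>v (m + n))"
    then have "(?S *\<^sub>v v) $ i = (\<Sum>j<m + n. ?S $$ (i, j) * x ^ (m + n - Suc j))"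
      by (simp add: v_def m_def n_def scalar_prod_def row_def lessThan_atLeast0)
    also have "\<dots> = 0"
    proof (cases "i < n")
      case True
      then have "(\<Sum>j<m + n. ?S $$ (i, j) * x ^ (m + n - Suc j))
          = (\<Sum>j<m + n. Polynomial.coeff (Polynomial.monom 1 (Suc (n - Suc i)) * p) (m + n - j) * x ^ (m + n - Suc j))"
        using i by (intro sum.cong) (simp_all add: sylvester_index_mat2 m_def n_def Suc_diff_Suc)
      also have "\<dots> = 0" using True p by (intro shifted) (simp_all add: m_def)
      finally show ?thesis .
    next
      case False
      then have "(\<Sum>j<m + n. ?S $$ (i, j) * x ^ (m + n - Suc j))
          = (\<Sum>j<m + n. Polynomial.coeff (Polynomial.monom 1 (Suc (m + n - Suc i)) * q) (m + n - j) * x ^ (m + n - Suc j))"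
        using i by (intro sum.cong) (simp_all add: sylvester_index_mat2 m_def n_def Suc_diff_Suc)
      also have "\<dots> = 0" using False q i by (intro shifted) (simp_all add: n_def)
      finally show ?thesis .
    qed
    finally show "(?S *\<^sub>v v) $ i = 0\<^sub>v (m + n) $ i" using i by simp
  qed (simp add: m_def n_def)
  moreover have "v \<in> carrier_vec (m + n)" by (simp add: v_def)
  \<comment> \<open>The last entry is \<open>x ^ 0 = 1\<close>, also for
    \<open>x = 0\<close>.\<close>
  moreover have "v \<noteq> 0\<^sub>v (m + n)"
  proof
    assume "v = 0\<^sub>v (m + n)"
    then have "v $ (m + n - 1) = 0" using N by (simp add: m_def n_def)
    then show False using N by (simp add: v_def m_def n_def)
  qed
  moreover have "?S \<in> carrier_mat (m + n) (m + n)"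
    by (simp add: m_def n_def sylvester_carrier_mat)
  ultimately show ?thesis
    unfolding resultant_def using det_0_iff_vec_prod_zero[of ?S "m + n"] by blast
qed

text \<open>Over the closure \<open>f\<close> is a product of linear factors. Their roots come from
  the ground field, and the factorization descends because \<open>map_poly to_ac\<close> is
  injective. A double root would be a common root of \<open>f\<close> and \<open>pderiv f\<close>
  and make the resultant vanish.\<close>

lemma separable_split:
  fixes f :: "'a::field poly"
  assumes monic: "Polynomial.lead_coeff f = 1" and disc: "discriminant f \<noteq> 0"
    and roots: "root_set (map_poly to_ac f) \<subseteq> range to_ac"
  shows "f = (\<Prod>\<beta>\<in>root_set f. [:- \<beta>, 1:])"
proof -
  let ?f = "map_poly to_ac f"
  have f0: "?f \<noteq> 0" using monic by auto
  have lead: "Polynomial.lead_coeff ?f = 1"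
    using monic by simp
  obtain A where A: "?f = (\<Prod>x\<in>#A. [:- x, 1:])"
    using alg_closed_imp_factorization[OF f0] lead by auto
  have "x \<in> range to_ac" if "x \<in># A" for x
  proof -
    have "[:- x, 1:] dvd (\<Prod>x\<in>#A. [:- x, 1:])"
      using that by (intro dvd_prod_mset) auto
    then have "poly ?f x = 0" unfolding A by (simp add: poly_eq_0_iff_dvd)
    then show ?thesis using roots by (auto simp: root_set_def)
  qed
  then have "image_mset to_ac (image_mset of_ac A) = A"
    by (induction A) (simp_all add: to_ac_of_ac)
  then obtain B where B: "A = image_mset to_ac B" by metis
  have "?f = map_poly to_ac (\<Prod>x\<in>#B. [:- x, 1:])"
    unfolding A B
    by (induction B) (simp_all add: map_to_ac_hom.hom_mult to_ac_hom.map_poly_pCons_hom del: mult_pCons_left)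
  then have f: "f = (\<Prod>x\<in>#B. [:- x, 1:])" by (simp only: map_to_ac_hom.eq_iff)
  have count: "count B x \<le> 1" for x
  proof (rule ccontr)
    assume "\<not> count B x \<le> 1"
    then have "{#x, x#} \<subseteq># B" by (simp add: subseteq_mset_def)
    then obtain C where "B = {#x, x#} + C" by (metis subset_mset.add_diff_inverse)
    then obtain g where g: "f = [:- x, 1:] * ([:- x, 1:] * g)" using f by simp
    have "poly f x = 0" by (subst g) simp
    moreover have "poly (pderiv f) x = 0"
      by (subst g) (simp add: pderiv_mult del: mult_pCons_left)
    moreover from \<open>poly f x = 0\<close> have "0 < Polynomial.degree f"
      using monic by (metis degree_eq_zeroE gr0I poly_const_conv lead_coeff_pCons(2) zero_neq_one)
    ultimately show False using disc resultant_common_root[of f x "pderiv f"]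
      by (simp add: discriminant_def)
  qed
  have "root_set f = set_mset B"
    unfolding f root_set_def by (induction B) auto
  moreover have "B = mset_set (set_mset B)"
  proof (rule multiset_eqI)
    fix x show "count B x = count (mset_set (set_mset B)) x"
    proof (cases "x \<in># B")
      case True
      then have "count B x = 1" using count[of x] count_greater_zero_iff[of B x] by linarith
      with True show ?thesis by simp
    qed (simp add: not_in_iff)
  qed
  ultimately show ?thesis
    using f by (metis prod_unfold_prod_mset)
qed

lemma order_linear_power: "Polynomial.order x ([:- b, 1:] ^ e) = (if x = b then e else 0)"
  for b :: "'a::idom"
  by (auto simp: order_power_n_n intro: order_0I)

lemma order_prod_linear_powers:
  fixes x :: "'a::idom"
  assumes "finite B"
  shows "Polynomial.order x (\<Prod>b\<in>B. [:- b, 1:] ^ e b) = (if x \<in> B then e x else 0)"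
  using assms
proof (induction B rule: finite_induct)
  case (insert b B)
  have "(\<Prod>b\<in>B. [:- b, 1:] ^ e b) \<noteq> 0" using insert by simp
  with insert show ?case by (auto simp: order_mult order_linear_power)
qed simp

section \<open>Valuations and reduction\<close>

context valued_field
begin

lemma val_zero [simp]: "v 0 = \<infinity>"
  by (simp add: val_eq_infty_iff)

lemma val_real:
  assumes "x \<noteq> 0"
  obtains a where "v x = ereal a"
  using assms val_eq_infty_iff[of x] val_neq_minf[of x] by (cases "v x") auto

lemma val_one [simp]: "v 1 = 0"
proof -
  obtain a where "v 1 = ereal a" by (rule val_real[of 1]) simp_all
  with val_mult[of 1 1] show ?thesis by (simp add: zero_ereal_def)
qed

lemma val_uminus [simp]: "v (- x) = v x"
proof -
  obtain a where a: "v (- 1) = ereal a" by (rule val_real[of "- 1"]) simp_all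
  then have "a = 0" using val_mult[of "- 1" "- 1"] by (simp add: zero_ereal_def)
  then show ?thesis using val_mult[of "- 1" x] a by (simp add: zero_ereal_def[symmetric])
qed

lemma val_diff_commute: "v (x - y) = v (y - x)"
  using val_uminus[of "x - y"] by simp

lemma val_diff_ultrametric: "min (v (x - y)) (v (y - z)) \<le> v (x - z)"
  using val_add[of "x - y" "y - z"] by simp

lemma val_trans_le: "d \<le> v (x - y) \<Longrightarrow> d \<le> v (y - z) \<Longrightarrow> d \<le> v (x - z)"
  using val_diff_ultrametric[of x y z] by (meson min.bounded_iff order_trans)

lemma val_add_nonneg: "0 \<le> v x \<Longrightarrow> 0 \<le> v y \<Longrightarrow> 0 \<le> v (x + y)"
  using val_add[of x y] by (meson min.bounded_iff order_trans)

lemma val_mult_nonneg: "0 \<le> v x \<Longrightarrow> 0 \<le> v y \<Longrightarrow> 0 \<le> v (x * y)"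
  by (simp add: val_mult)

lemma val_power_nonneg: "0 \<le> v x \<Longrightarrow> 0 \<le> v (x ^ (i::nat))"
  by (induction i) (simp_all add: val_mult_nonneg)

lemma val_sum_nonneg: "(\<And>i. i \<in> J \<Longrightarrow> 0 \<le> v (f i)) \<Longrightarrow> 0 \<le> v (\<Sum>i\<in>J. f i)"
  by (induction J rule: infinite_finite_induct) (simp_all add: val_add_nonneg)

text \<open>Finite values are real numbers, so they have no torsion. Applied to the root of unity
  \<open>\<zeta>\<close> and to \<open>\<gamma>\<close>.\<close>

lemma val_power_eq_zero:
  assumes "v (x ^ d) = 0" "d > 0"
  shows "v x = 0"
proof -
  have "x \<noteq> 0" using assms by (auto simp: power_0_left)
  then obtain a where a: "v x = ereal a" by (rule val_real)
  have "v (x ^ i) = ereal (of_nat i * a)" for i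
    by (induction i) (simp_all add: val_mult a algebra_simps zero_ereal_def[symmetric])
  with assms a show ?thesis by (simp add: zero_ereal_def)
qed

lemma val_prod_zero:
  assumes "\<And>i. i \<in> J \<Longrightarrow> v (f i) = 0"
  shows "v (\<Prod>i\<in>J. f i) = 0"
  using assms by (induction J rule: infinite_finite_induct) (simp_all add: val_mult)

end

context complete_discretely_valued_field
begin

lemma uniformizer_nonzero: "\<pi> \<noteq> 0"
  using val_uniformizer val_zero by auto

lemma val_int_val:
  assumes "x \<noteq> 0"
  shows "v x = ereal (of_int (int_val (v x)))"
  using val_int[OF assms] by (auto simp: int_val_def)

lemma val_inverse_uniformizer: "v (inverse \<pi>) = ereal (- 1)"
proof -
  have "inverse \<pi> \<noteq> 0" using uniformizer_nonzero by simp
  then obtain a where a: "v (inverse \<pi>) = ereal a" by (rule val_real)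
  then have "ereal (1 + a) = 0"
    using val_mult[of \<pi> "inverse \<pi>"] uniformizer_nonzero
    by (simp add: val_uniformizer one_ereal_def)
  with a show ?thesis by (simp add: zero_ereal_def)
qed

lemma val_uniformizer_powi: "v (\<pi> powi k) = ereal (of_int k)"
proof (cases "k \<ge> 0")
  case True
  have "v (\<pi> ^ i) = ereal (of_nat i)" for i
    by (induction i) (simp_all add: val_mult val_uniformizer zero_ereal_def one_ereal_def)
  with True show ?thesis by (simp add: power_int_def)
next
  case False
  have "v (inverse \<pi> ^ i) = ereal (- of_nat i)" for i
    by (induction i) (simp_all add: val_mult val_inverse_uniformizer zero_ereal_def)
  with False show ?thesis by (simp add: power_int_def)
qed

lemma val_scaled: "v (x / \<pi> powi k) = v x - ereal (of_int k)"
proof -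
  have "x / \<pi> powi k = x * \<pi> powi (- k)"
    by (simp add: power_int_minus field_simps)
  then show ?thesis
    by (simp add: val_mult val_uniformizer_powi) (cases "v x"; simp)
qed

lemma val_scaled_nonneg_iff: "0 \<le> v (x / \<pi> powi k) \<longleftrightarrow> ereal (of_int k) \<le> v x"
  unfolding val_scaled by (cases "v x") simp_all

lemma val_scaled_pos_iff: "0 < v (x / \<pi> powi k) \<longleftrightarrow> ereal (of_int k) < v x"
  unfolding val_scaled by (cases "v x") simp_all

end

context residue_map
begin

lemma red_zero [simp]: "\<rho> 0 = 0"
  using red_eq_0_iff[of 0] by simp

lemma red_uminus: "0 \<le> v x \<Longrightarrow> \<rho> (- x) = - \<rho> x"
  using red_add[of x "- x"] by (simp add: eq_neg_iff_add_eq_0 add.commute)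

lemma red_diff: "0 \<le> v x \<Longrightarrow> 0 \<le> v y \<Longrightarrow> \<rho> (x - y) = \<rho> x - \<rho> y"
  using red_add[of x "- y"] by (simp add: red_uminus)

lemma red_eq_iff: "0 \<le> v x \<Longrightarrow> 0 \<le> v y \<Longrightarrow> \<rho> x = \<rho> y \<longleftrightarrow> 0 < v (x - y)"
  using red_diff[of x y] red_eq_0_iff[of "x - y"] val_add_nonneg[of x "- y"] by auto

lemma red_power: "0 \<le> v x \<Longrightarrow> \<rho> (x ^ i) = \<rho> x ^ i"
  by (induction i) (simp_all add: red_one red_mult val_power_nonneg)

lemma red_sum:
  assumes "\<And>i. i \<in> J \<Longrightarrow> 0 \<le> v (f i)"
  shows "\<rho> (\<Sum>i\<in>J. f i) = (\<Sum>i\<in>J. \<rho> (f i))"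
  using assms
  by (induction J rule: infinite_finite_induct) (simp_all add: red_add val_sum_nonneg)

lemma red_prod:
  assumes "\<And>i. i \<in> J \<Longrightarrow> 0 \<le> v (f i)"
  shows "0 \<le> v (\<Prod>i\<in>J. f i)" "\<rho> (\<Prod>i\<in>J. f i) = (\<Prod>i\<in>J. \<rho> (f i))"
  using assms
  by (induction J rule: infinite_finite_induct) (simp_all add: red_one red_mult val_mult_nonneg)

definition integral_poly :: "'a poly \<Rightarrow> bool" where
  "integral_poly p \<longleftrightarrow> (\<forall>i. 0 \<le> v (Polynomial.coeff p i))"

lemma coeff_red_poly: "Polynomial.coeff (map_poly \<rho> p) i = \<rho> (Polynomial.coeff p i)"
  by (rule coeff_map_poly) simp

lemma integral_poly_mult: "integral_poly p \<Longrightarrow> integral_poly q \<Longrightarrow> integral_poly (p * q)"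
  unfolding integral_poly_def coeff_mult by (intro allI val_sum_nonneg val_mult_nonneg) auto

lemma red_poly_mult:
  assumes "integral_poly p" "integral_poly q"
  shows "map_poly \<rho> (p * q) = map_poly \<rho> p * map_poly \<rho> q"
proof (rule poly_eqI)
  fix i
  have "0 \<le> v (Polynomial.coeff p j)" "0 \<le> v (Polynomial.coeff q j)" for j
    using assms by (simp_all add: integral_poly_def)
  then show "Polynomial.coeff (map_poly \<rho> (p * q)) i = Polynomial.coeff (map_poly \<rho> p * map_poly \<rho> q) i"
    by (simp add: coeff_red_poly coeff_mult red_sum red_mult val_mult_nonneg)
qed

lemma integral_poly_one: "integral_poly 1"
  by (simp add: integral_poly_def one_pCons coeff_pCons split: nat.split)

lemma red_poly_one: "map_poly \<rho> 1 = 1"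
  by (rule poly_eqI) (simp add: coeff_red_poly red_one)

lemma red_poly_prod:
  assumes "\<And>i. i \<in> J \<Longrightarrow> integral_poly (f i)"
  shows "integral_poly (\<Prod>i\<in>J. f i)" "map_poly \<rho> (\<Prod>i\<in>J. f i) = (\<Prod>i\<in>J. map_poly \<rho> (f i))"
  using assms
  by (induction J rule: infinite_finite_induct)
    (simp_all add: integral_poly_one red_poly_one red_poly_mult integral_poly_mult)

lemma integral_poly_linear: "integral_poly [:a, b:] \<longleftrightarrow> 0 \<le> v a \<and> 0 \<le> v b"
  by (auto simp: integral_poly_def coeff_pCons split: nat.splits)

lemma red_poly_linear: "map_poly \<rho> [:a, b:] = [:\<rho> a, \<rho> b:]"
  by (rule poly_eqI) (simp add: coeff_red_poly coeff_pCons split: nat.split)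

text \<open>A nonzero reduction means that some coefficient of \<open>G\<close> is a unit while the
  others are integral, so \<open>G\<close> itself has content of valuation 0.\<close>

lemma content_val_smult:
  assumes G: "integral_poly G" and nz: "map_poly \<rho> G \<noteq> 0" and k: "k \<noteq> 0"
  shows "content_val v (smult k G) = v k"
proof -
  obtain i where i: "\<rho> (Polynomial.coeff G i) \<noteq> 0"
    using nz by (metis coeff_red_poly leading_coeff_0_iff)
  then have vi: "v (Polynomial.coeff G i) = 0"
    using G red_eq_0_iff[of "Polynomial.coeff G i"] by (auto simp: integral_poly_def order.order_iff_strict)
  have "Polynomial.coeff (smult k G) i \<noteq> 0" using i k by auto
  then have "i \<le> Polynomial.degree (smult k G)" by (rule le_degree)
  show ?thesis
    unfolding content_val_def
  proof (rule Min_eqI)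
    show "v k \<in> (\<lambda>i. v (Polynomial.coeff (smult k G) i)) ` {..Polynomial.degree (smult k G)}"
      using \<open>i \<le> _\<close> vi by (auto simp: val_mult intro!: image_eqI[of _ _ i])
    show "v k \<le> y"
      if "y \<in> (\<lambda>i. v (Polynomial.coeff (smult k G) i)) ` {..Polynomial.degree (smult k G)}" for y
      using that G by (auto simp: val_mult integral_poly_def intro: ereal_le_add_self)
  qed simp
qed

end

section \<open>Clusters\<close>

context valued_field
begin

lemma val_diff_sym: "val_diff v p q = val_diff v q p"
  by (cases p; cases q) (simp_all add: val_diff_commute)

lemma val_diff_triangle: "min (val_diff v p q) (val_diff v q s) \<le> val_diff v p s"
  by (cases p; cases q; cases s) (simp_all add: val_diff_ultrametric)

text \<open>By the ultrametric inequality, which also holds with the value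
  \<open>-\<infinity>\<close> for the point at infinity, the smallest of the three mutual valuations
  is attained twice. The three candidates correspond to the choice of the closest pair.\<close>

lemma ordered_permutation_exists: "\<exists>t'. permuted_triple t t' \<and> ordered_triple v t'"
proof -
  obtain a b c where t: "t = (a, b, c)" by (cases t) auto
  have "min (val_diff v a b) (val_diff v b c) \<le> val_diff v a c"
    "min (val_diff v a c) (val_diff v b c) \<le> val_diff v a b"
    "min (val_diff v a b) (val_diff v a c) \<le> val_diff v b c"
    using val_diff_triangle[of a b c] val_diff_triangle[of a c b] val_diff_triangle[of b a c]
    by (simp_all add: val_diff_sym)
  then have "ordered_triple v (a, b, c) \<or> ordered_triple v (a, c, b) \<or> ordered_triple v (b, c, a)"
    unfolding ordered_triple.simps val_diff_sym[of c b] val_diff_sym[of b a] val_diff_sym[of c a]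
    by (auto simp: min_def split: if_splits)
  moreover have "permuted_triple t (a, b, c)" "permuted_triple t (a, c, b)" "permuted_triple t (b, c, a)"
    by (simp_all add: t)
  ultimately show ?thesis by blast
qed

end

lemma permuted_triple_mem_triples:
  assumes "permuted_triple t t'" "t \<in> triples S"
  shows "t' \<in> triples S"
proof -
  obtain a b c a' b' c' where t: "t = (a, b, c)" "t' = (a', b', c')" by (cases t; cases t') auto
  have "mset [a, b, c] = mset [a', b', c']" using assms(1) by (simp add: t)
  then have "set [a, b, c] = set [a', b', c']" "distinct [a, b, c] = distinct [a', b', c']"
    by (rule mset_eq_setD, rule mset_eq_imp_distinct_iff)
  with assms(2) show ?thesis by (auto simp: t triples_def)
qed

text \<open>In an ordered triple of distinct points infinity can only be the third entry: as first
  or second entry it would make exactly one of the two valuations that must be equal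
  \<open>-\<infinity>\<close>. So \<open>a\<close> and \<open>b\<close> are roots.\<close>

lemma Phi_triple:
  fixes v :: "'a::field \<Rightarrow> ereal"
  assumes "valued_field v" and ext: "\<And>x. vb (to_ac x) = v x"
    and t: "t \<in> triples (branch_points n f)"
  obtains a b where "a \<in> root_set f" "b \<in> root_set f" "a \<noteq> b"
    "Phi vb (root_set f) t = {x \<in> root_set f. v (a - b) \<le> v (x - a)}"
proof -
  interpret valued_field v by fact
  have vb: "vb \<circ> to_ac = v" using ext by auto
  define t' where "t' = (SOME t'. permuted_triple t t' \<and> ordered_triple v t')"
  have t': "permuted_triple t t'" "ordered_triple v t'"
    using someI_ex[OF ordered_permutation_exists[of t]] by (simp_all add: t'_def)
  have t'_mem: "t' \<in> triples (branch_points n f)"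
    using permuted_triple_mem_triples[OF t'(1) t] .
  obtain p q s where pqs: "t' = (p, q, s)" by (cases t') auto
  have distinct: "p \<noteq> q" "p \<noteq> s" "q \<noteq> s" using t'_mem by (auto simp: pqs triples_def)
  have ord: "val_diff v p s = val_diff v q s" using t'(2) by (simp add: pqs)
  have finite_val: "val_diff v (Finite x) (Finite y) \<noteq> -\<infinity>" for x y
    by (simp add: val_neq_minf)
  obtain a where p: "p = Finite a"
    using distinct ord finite_val by (cases p; cases q; cases s) auto
  obtain b where q: "q = Finite b"
    using distinct ord finite_val by (cases p; cases q; cases s) auto
  have "a \<in> root_set f" "b \<in> root_set f"
    using t'_mem by (auto simp: pqs p q triples_def branch_points_def split: if_splits)
  moreover have "a \<noteq> b" using distinct by (simp add: p q)
  moreover have "Phi vb (root_set f) t = {x \<in> root_set f. v (a - b) \<le> v (x - a)}"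
    unfolding Phi_def vb t'_def[symmetric] pqs p q
    by (simp add: disc_def ext flip: to_ac_diff)
  ultimately show ?thesis using that by blast
qed

text \<open>A disc of an ultrametric has every point as a centre, so \<open>s\<close> is described
  from the given \<open>r\<close>; \<open>diameter_attained\<close> makes its radius
  \<open>\<mu>\<close> the exact diameter.\<close>

locale cluster =
  complete_discretely_valued_field v \<pi> + residue_map v \<rho>
  for v :: "'a::field \<Rightarrow> ereal" and \<pi> :: 'a and \<rho> :: "'a \<Rightarrow> 'k::field" +
  fixes R s :: "'a set" and r :: 'a and \<mu> :: int
  assumes finite_R: "finite R" and r: "r \<in> s"
    and s_eq: "s = {x \<in> R. ereal (of_int \<mu>) \<le> v (x - r)}"
    and diameter_attained: "\<exists>a\<in>s. \<exists>b\<in>s. v (a - b) = ereal (of_int \<mu>)"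
begin

lemma finite_s: "finite s"
  using finite_R by (simp add: s_eq)

lemma s_subset: "s \<subseteq> R"
  by (auto simp: s_eq)

lemma val_diff_ge: "x \<in> s \<Longrightarrow> y \<in> s \<Longrightarrow> ereal (of_int \<mu>) \<le> v (x - y)"
  using val_trans_le[of _ x r y] by (auto simp: s_eq val_diff_commute[of r y])

lemma mem_s: "x \<in> s \<Longrightarrow> y \<in> R \<Longrightarrow> ereal (of_int \<mu>) \<le> v (y - x) \<Longrightarrow> y \<in> s"
  using val_trans_le[of _ y x r] by (auto simp: s_eq)

text \<open>The value at the root \<open>x\<close> of the variable \<open>x_t\<close> of the reduced
  curve.\<close>

definition coord :: "'a \<Rightarrow> 'k" where
  "coord x = \<rho> ((x - r) / \<pi> powi \<mu>)"

lemma coord_integral: "x \<in> s \<Longrightarrow> 0 \<le> v ((x - r) / \<pi> powi \<mu>)"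
  by (simp add: val_scaled_nonneg_iff s_eq)

lemma coord_eq_iff:
  assumes "x \<in> s" "y \<in> s"
  shows "coord x = coord y \<longleftrightarrow> ereal (of_int \<mu>) < v (x - y)"
proof -
  have "(x - r) / \<pi> powi \<mu> - (y - r) / \<pi> powi \<mu> = (x - y) / \<pi> powi \<mu>"
    by (simp add: diff_divide_distrib)
  then show ?thesis
    unfolding coord_def using red_eq_iff[OF coord_integral coord_integral] assms
    by (simp add: val_scaled_pos_iff)
qed

definition fiber :: "'k \<Rightarrow> 'a set" where
  "fiber b = {x \<in> s. coord x = b}"

text \<open>The children are the residue discs in the coordinate \<open>x_t\<close>: a proper
  subcluster of \<open>s\<close> is cut out by a disc of radius greater than \<open>\<mu>\<close>,
  hence all its points have the same reduced coordinate, and each fiber is itself a cluster.\<close>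

lemma children_eq:
  fixes vb :: "'a alg_closure \<Rightarrow> ereal"
  assumes vb: "valued_field vb" and ext: "\<And>x. vb (to_ac x) = v x"
  shows "children vb R s = fiber ` coord ` s"
proof -
  interpret vb: valued_field vb by fact
  have ext_diff: "vb (to_ac x - to_ac y) = v (x - y)" for x y
    by (simp add: ext flip: to_ac_diff)
  have fiber_cluster: "fiber (coord x) \<in> clusters vb R" if x: "x \<in> s" for x
  proof -
    \<comment> \<open>Clusters are cut out by closed discs, while a fiber is an open condition.
      Valuations on the ground field are integers, so greater than \<open>\<mu>\<close> means at
      least \<open>\<mu> + 1\<close>.\<close>
    have "fiber (coord x) = {y \<in> R. to_ac y \<in> disc vb (to_ac x) (ereal (of_rat (of_int (\<mu> + 1))))}"
    proof (intro equalityI subsetI)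
      fix y assume y: "y \<in> fiber (coord x)"
      then have less: "ereal (of_int \<mu>) < v (y - x)" and "y \<in> s"
        using coord_eq_iff[of y x] x by (auto simp: fiber_def)
      have "ereal (of_int (\<mu> + 1)) \<le> v (y - x)"
      proof (cases "y = x")
        case False
        then show ?thesis using less val_int_val[of "y - x"] by (metis ereal_less_eq(3) eq_iff_diff_eq_0
            ereal_less(2) less_ereal.simps(1) of_int_le_iff of_int_less_iff zless_imp_add1_zle)
      qed simp
      then show "y \<in> {y \<in> R. to_ac y \<in> disc vb (to_ac x) (ereal (of_rat (of_int (\<mu> + 1))))}"
        using \<open>y \<in> s\<close> s_subset by (auto simp: disc_def ext_diff of_rat_add)
    next
      fix y assume y: "y \<in> {y \<in> R. to_ac y \<in> disc vb (to_ac x) (ereal (of_rat (of_int (\<mu> + 1))))}"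
      then have "ereal (of_int (\<mu> + 1)) \<le> v (y - x)" by (simp add: disc_def ext_diff of_rat_add)
      moreover have "ereal (of_int \<mu>) < ereal (of_int (\<mu> + 1))" by simp
      ultimately have less: "ereal (of_int \<mu>) < v (y - x)" by (rule order_less_le_trans[rotated])
      then have "y \<in> s" using mem_s[OF x, of y] y by auto
      with less x show "y \<in> fiber (coord x)" by (simp add: fiber_def coord_eq_iff)
    qed
    moreover have "fiber (coord x) \<noteq> {}" using x by (auto simp: fiber_def)
    ultimately show ?thesis unfolding clusters_def by blast
  qed
  have fiber_proper: "fiber b \<subset> s" for b
  proof -
    obtain x y where xy: "x \<in> s" "y \<in> s" "v (x - y) = ereal (of_int \<mu>)"
      using diameter_attained by auto
    then have "coord x \<noteq> coord y" by (simp add: coord_eq_iff)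
    then obtain w where "w \<in> s" "coord w \<noteq> b" using xy(1,2) by metis
    then show ?thesis by (auto simp: fiber_def)
  qed
  have in_fiber: "u \<subseteq> fiber (coord x)" if u: "u \<in> clusters vb R" "u \<subset> s" "x \<in> u" for u x
  proof -
    obtain w and e :: rat where w: "u = {y \<in> R. ereal (of_rat e) \<le> vb (to_ac y - w)}"
      using u(1) by (auto simp: clusters_def disc_def)
    have x: "x \<in> s" using u by auto
    have close: "ereal (of_rat e) \<le> v (y - x)" if "y \<in> u" for y
      using vb.val_trans_le[of _ "to_ac y" w "to_ac x"] that u(3)
      by (auto simp: w vb.val_diff_commute[of w] ext_diff)
    obtain y where y: "y \<in> s" "y \<notin> u" using u(2) by auto
    \<comment> \<open>A disc of radius at most \<open>\<mu>\<close> that meets \<open>s\<close>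
      contains all of \<open>s\<close>, so \<open>u\<close> would not be proper.\<close>
    have "\<not> ereal (of_rat e) \<le> ereal (of_int \<mu>)"
    proof
      assume "ereal (of_rat e) \<le> ereal (of_int \<mu>)"
      also have "\<dots> \<le> v (y - x)" using val_diff_ge[OF y(1) x] .
      finally have "ereal (of_rat e) \<le> vb (to_ac y - w)"
        using vb.val_trans_le[of _ "to_ac y" "to_ac x" w] u(3) by (simp add: w ext_diff)
      then show False using y s_subset by (auto simp: w)
    qed
    then have less: "ereal (of_int \<mu>) < ereal (of_rat e)" by simp
    show ?thesis
    proof
      fix y assume y: "y \<in> u"
      then have "y \<in> s" using u(2) by auto
      moreover have "ereal (of_int \<mu>) < v (y - x)"
        using less close[OF y] by (rule order_less_le_trans)
      ultimately show "y \<in> fiber (coord x)"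
        using x by (simp add: fiber_def coord_eq_iff)
    qed
  qed
  have fibers_eq: "fiber (coord x) = fiber (coord y)" if "x \<in> fiber (coord y)" for x y
    using that by (simp add: fiber_def)
  show ?thesis
  proof (intro equalityI subsetI)
    fix u assume u: "u \<in> children vb R s"
    then obtain x where x: "x \<in> u" by (auto simp: children_def clusters_def)
    have "x \<in> s" using u x by (auto simp: children_def)
    have "u \<subseteq> fiber (coord x)" using u x in_fiber by (auto simp: children_def)
    moreover have "\<not> u \<subset> fiber (coord x)"
      using u fiber_cluster[OF \<open>x \<in> s\<close>] fiber_proper[of "coord x"]
      unfolding children_def by blast
    ultimately have "u = fiber (coord x)" by blast
    then show "u \<in> fiber ` coord ` s" using \<open>x \<in> s\<close> by blast
  next
    fix u assume "u \<in> fiber ` coord ` s"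
    then obtain x where x: "x \<in> s" "u = fiber (coord x)" by auto
    have "\<not> u \<subset> u'" if u': "u' \<in> clusters vb R" "u' \<subset> s" for u'
    proof
      assume less: "u \<subset> u'"
      \<comment> \<open>The larger cluster lies in a single fiber; this must be \<open>u\<close>, so
        nothing lies strictly between \<open>u\<close> and \<open>s\<close>.\<close>
      then obtain y where y: "y \<in> u'" "y \<in> u" using x by (auto simp: fiber_def)
      have "u' \<subseteq> fiber (coord y)" using in_fiber[OF u' y(1)] .
      with less fibers_eq[of y x] y(2) x(2) show False by auto
    qed
    then show "u \<in> children vb R s"
      using fiber_cluster[OF x(1)] fiber_proper[of "coord x"] x(2)
      unfolding children_def by blast
  qed
qed

section \<open>Reduction of the polynomial on the disc of the cluster\<close>

definition expo :: "'a \<Rightarrow> int" where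
  "expo \<beta> = (if \<beta> \<in> s then \<mu> else int_val (v (r - \<beta>)))"

text \<open>The linear polynomial \<open>\<pi>^\<mu> x_t + (r - \<beta>)\<close> divided by its
  content. The valuation \<open>expo \<beta>\<close> of that content is \<open>\<mu>\<close> when
  \<open>\<beta>\<close> is in \<open>s\<close> and \<open>v (r - \<beta>) < \<mu>\<close>
  otherwise, so outside \<open>s\<close> only the constant term survives reduction.\<close>

definition scaled_factor :: "'a \<Rightarrow> 'a poly" where
  "scaled_factor \<beta> = [:(r - \<beta>) / \<pi> powi expo \<beta>, \<pi> powi (\<mu> - expo \<beta>):]"

lemma expo_outside:
  assumes "\<beta> \<in> R - s"
  shows "v (r - \<beta>) = ereal (of_int (expo \<beta>))" "expo \<beta> < \<mu>"
proof -
  have "r \<noteq> \<beta>" using assms r by auto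
  then show eq: "v (r - \<beta>) = ereal (of_int (expo \<beta>))"
    using assms val_int_val[of "r - \<beta>"] by (simp add: expo_def)
  have "\<not> ereal (of_int \<mu>) \<le> v (r - \<beta>)"
    using assms by (auto simp: s_eq val_diff_commute[of r \<beta>])
  then show "expo \<beta> < \<mu>" by (simp add: eq)
qed

lemma scaled_factor_integral:
  assumes "\<beta> \<in> R"
  shows "integral_poly (scaled_factor \<beta>)"
proof (cases "\<beta> \<in> s")
  case True
  then have "ereal (of_int (expo \<beta>)) \<le> v (r - \<beta>)" "expo \<beta> = \<mu>"
    using val_diff_ge[OF r True] by (simp_all add: expo_def)
  then show ?thesis
    by (simp add: scaled_factor_def integral_poly_linear val_scaled_nonneg_iff)
next
  case False
  with assms expo_outside[of \<beta>] show ?thesis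
    by (simp add: scaled_factor_def integral_poly_linear val_scaled_nonneg_iff val_uniformizer_powi)
qed

lemma scaled_factor_red_inside: "\<beta> \<in> s \<Longrightarrow> map_poly \<rho> (scaled_factor \<beta>) = [:- coord \<beta>, 1:]"
proof -
  assume \<beta>: "\<beta> \<in> s"
  have "(r - \<beta>) / \<pi> powi \<mu> = - ((\<beta> - r) / \<pi> powi \<mu>)" by (simp add: minus_divide_left)
  then show ?thesis
    using \<beta> red_uminus[OF coord_integral[OF \<beta>]]
    by (simp add: scaled_factor_def red_poly_linear expo_def red_one coord_def)
qed

lemma scaled_factor_red_outside:
  "\<beta> \<in> R - s \<Longrightarrow> map_poly \<rho> (scaled_factor \<beta>) = [:\<rho> ((r - \<beta>) / \<pi> powi expo \<beta>):]"
  using red_eq_0_iff[of "\<pi> powi (\<mu> - expo \<beta>)"] expo_outside[of \<beta>]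
  by (simp add: scaled_factor_def red_poly_linear val_uniformizer_powi)

text \<open>The constant \<open>c_t\<close> of the theorem.\<close>

definition outer_unit :: 'a where
  "outer_unit = (\<Prod>\<beta>\<in>R - s. (r - \<beta>) / \<pi> powi int_val (v (r - \<beta>)))"

lemma outer_unit_eq: "outer_unit = (\<Prod>\<beta>\<in>R - s. (r - \<beta>) / \<pi> powi expo \<beta>)"
  unfolding outer_unit_def by (rule prod.cong) (simp_all add: expo_def)

lemma outer_factor_val: "\<beta> \<in> R - s \<Longrightarrow> v ((r - \<beta>) / \<pi> powi expo \<beta>) = 0"
  using expo_outside[of \<beta>] by (simp add: val_scaled zero_ereal_def)

lemma val_outer_unit: "v outer_unit = 0"
  unfolding outer_unit_eq by (rule val_prod_zero) (rule outer_factor_val)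

lemma red_outer_unit: "\<rho> outer_unit \<noteq> 0"
  using red_eq_0_iff[of outer_unit] by (simp add: val_outer_unit)

lemma red_prod_scaled_factors:
  "map_poly \<rho> (\<Prod>\<beta>\<in>R. scaled_factor \<beta>) = smult (\<rho> outer_unit) (\<Prod>b\<in>coord ` s. [:- b, 1:] ^ card (fiber b))"
proof -
  have "map_poly \<rho> (\<Prod>\<beta>\<in>R. scaled_factor \<beta>) = (\<Prod>\<beta>\<in>R. map_poly \<rho> (scaled_factor \<beta>))"
    using scaled_factor_integral by (rule red_poly_prod(2))
  also have "\<dots> = (\<Prod>\<beta>\<in>R - s. map_poly \<rho> (scaled_factor \<beta>)) * (\<Prod>\<beta>\<in>s. map_poly \<rho> (scaled_factor \<beta>))"
    using finite_R s_subset by (rule prod.subset_diff[rotated])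
  also have "(\<Prod>\<beta>\<in>R - s. map_poly \<rho> (scaled_factor \<beta>)) = (\<Prod>\<beta>\<in>R - s. [:\<rho> ((r - \<beta>) / \<pi> powi expo \<beta>):])"
    by (rule prod.cong) (simp_all add: scaled_factor_red_outside)
  also have "\<dots> = [:\<Prod>\<beta>\<in>R - s. \<rho> ((r - \<beta>) / \<pi> powi expo \<beta>):]"
    by (induction "R - s" rule: infinite_finite_induct) (simp_all add: one_pCons prod_to_poly)
  also have "(\<Prod>\<beta>\<in>R - s. \<rho> ((r - \<beta>) / \<pi> powi expo \<beta>)) = \<rho> outer_unit"
    unfolding outer_unit_eq by (rule red_prod(2)[symmetric]) (simp add: outer_factor_val)
  also have "(\<Prod>\<beta>\<in>s. map_poly \<rho> (scaled_factor \<beta>)) = (\<Prod>\<beta>\<in>s. [:- coord \<beta>, 1:])"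
    by (rule prod.cong) (simp_all add: scaled_factor_red_inside)
  \<comment> \<open>Roots with the same reduced coordinate are collected; by
    \<open>children_eq\<close> the exponents become the sizes of the children.\<close>
  also have "\<dots> = (\<Prod>b\<in>coord ` s. \<Prod>\<beta>\<in>{\<beta>\<in>s. coord \<beta> = b}. [:- coord \<beta>, 1:])"
    using finite_s by (rule prod.image_gen)
  also have "\<dots> = (\<Prod>b\<in>coord ` s. [:- b, 1:] ^ card (fiber b))"
    by (rule prod.cong) (simp_all add: fiber_def)
  finally show ?thesis by simp
qed

text \<open>Pulling the content out of each linear factor gives \<open>F = \<pi>^E G\<close> with
  \<open>E\<close> the sum of the \<open>expo \<beta>\<close>. As \<open>G\<close> has nonzero
  reduction, \<open>E\<close> is the valuation of the content of \<open>F\<close>, and the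
  normalized polynomial is \<open>G\<close>.\<close>

lemma reduced_equation:
  fixes f :: "'a poly"
  assumes f: "f = (\<Prod>\<beta>\<in>R. [:- \<beta>, 1:])"
  defines "F \<equiv> pcompose f [:r, \<pi> powi \<mu>:]"
  shows "map_poly \<rho> (smult (\<pi> powi (- int_val (content_val v F))) F)
    = smult (\<rho> outer_unit) (\<Prod>b\<in>coord ` s. [:- b, 1:] ^ card (fiber b))"
proof -
  let ?G = "\<Prod>\<beta>\<in>R. scaled_factor \<beta>"
  define E where "E = (\<Sum>\<beta>\<in>R. expo \<beta>)"
  have "pcompose [:- \<beta>, 1:] [:r, \<pi> powi \<mu>:] = smult (\<pi> powi expo \<beta>) (scaled_factor \<beta>)" for \<beta>
    using uniformizer_nonzero by (simp add: scaled_factor_def pcompose_pCons flip: power_int_add)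
  then have "F = (\<Prod>\<beta>\<in>R. smult (\<pi> powi expo \<beta>) (scaled_factor \<beta>))"
    by (simp add: F_def f pcompose_prod)
  also have "\<dots> = smult (\<Prod>\<beta>\<in>R. \<pi> powi expo \<beta>) ?G"
    by (rule prod_smult)
  also have "(\<Prod>\<beta>\<in>R. \<pi> powi expo \<beta>) = \<pi> powi E"
    unfolding E_def using finite_R
    by (induction R rule: finite_induct) (simp_all add: power_int_add uniformizer_nonzero)
  finally have F: "F = smult (\<pi> powi E) ?G" .
  have G: "integral_poly ?G" using scaled_factor_integral by (rule red_poly_prod(1))
  have "(\<Prod>b\<in>coord ` s. [:- b, 1:] ^ card (fiber b)) \<noteq> 0"
    using finite_s by simp
  then have nz: "map_poly \<rho> ?G \<noteq> 0"
    using red_outer_unit by (simp add: red_prod_scaled_factors)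
  have "content_val v F = ereal (of_int E)"
    unfolding F using content_val_smult[OF G nz] uniformizer_nonzero
    by (simp add: val_uniformizer_powi)
  then have "int_val (content_val v F) = E" by (simp add: int_val_def)
  then have "smult (\<pi> powi (- int_val (content_val v F))) F = ?G"
    using uniformizer_nonzero by (simp add: F power_int_minus)
  then show ?thesis by (simp add: red_prod_scaled_factors)
qed

end

section \<open>The reduced curve\<close>

lemma diameter_eqI:
  assumes "finite s" "a \<in> s" "b \<in> s" "\<And>x y. x \<in> s \<Longrightarrow> y \<in> s \<Longrightarrow> v (a - b) \<le> v (x - y)"
  shows "diameter v s = v (a - b)"
  unfolding diameter_def using assms by (intro Min_eqI) auto

text \<open>For \<open>0 < j < n\<close> the geometric sum of the powers of
  \<open>\<zeta> ^ j\<close> vanishes, since \<open>\<zeta> ^ j\<close> is an \<open>n\<close>-th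
  root of unity other than 1. If \<open>\<zeta> ^ j\<close> reduced to 1, this sum would reduce to
  \<open>n\<close>, which is nonzero in the residue field.\<close>

lemma (in residue_map) red_root_of_unity_inj:
  assumes n: "\<not> CHAR('b) dvd n" and \<zeta>: "\<zeta> ^ n = 1" "\<And>j. 0 < j \<Longrightarrow> j < n \<Longrightarrow> \<zeta> ^ j \<noteq> 1"
  shows "v \<zeta> = 0" "inj_on (\<lambda>j. \<rho> \<zeta> ^ j) {..<n}"
proof -
  have n0: "n > 0" using n by (intro gr0I) auto
  show v\<zeta>: "v \<zeta> = 0" by (rule val_power_eq_zero[OF _ n0]) (simp add: \<zeta>(1))
  have "\<zeta> \<noteq> 0" using v\<zeta> by auto
  have red_neq_1: "\<rho> \<zeta> ^ j \<noteq> 1" if j: "0 < j" "j < n" for j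
  proof
    assume eq: "\<rho> \<zeta> ^ j = 1"
    have "(\<zeta> ^ j) ^ n = 1" using \<zeta>(1) by (metis mult.commute power_mult power_one)
    then have "(\<zeta> ^ j - 1) * (\<Sum>i<n. (\<zeta> ^ j) ^ i) = 0" by (simp flip: power_diff_1_eq)
    then have "(\<Sum>i<n. (\<zeta> ^ j) ^ i) = 0" using \<zeta>(2)[OF j] by simp
    then have "(\<Sum>i<n. \<rho> ((\<zeta> ^ j) ^ i)) = 0"
      using red_sum[of "{..<n}" "\<lambda>i. (\<zeta> ^ j) ^ i"] v\<zeta> by (simp add: val_power_nonneg)
    then have "(\<Sum>i<n. (\<rho> \<zeta> ^ j) ^ i) = 0" using v\<zeta> by (simp add: red_power val_power_nonneg)
    then have "(of_nat n :: 'b) = 0" by (simp add: eq)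
    then show False using n by (simp add: of_nat_eq_0_iff_char_dvd)
  qed
  have nz: "\<rho> \<zeta> \<noteq> 0" using red_eq_0_iff[of \<zeta>] v\<zeta> by simp
  have less: "\<rho> \<zeta> ^ i \<noteq> \<rho> \<zeta> ^ j" if "i < j" "j < n" for i j
  proof -
    have "\<rho> \<zeta> ^ j = \<rho> \<zeta> ^ i * \<rho> \<zeta> ^ (j - i)" using that by (simp flip: power_add)
    then show ?thesis using red_neq_1[of "j - i"] that nz by auto
  qed
  show "inj_on (\<lambda>j. \<rho> \<zeta> ^ j) {..<n}"
  proof (rule inj_onI)
    fix i j assume "i \<in> {..<n}" "j \<in> {..<n}" "\<rho> \<zeta> ^ i = \<rho> \<zeta> ^ j"
    then show "i = j" using less[of i j] less[of j i] by (cases i j rule: linorder_cases) auto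
  qed
qed

theorem proposition3p1:
  fixes v :: "'a::field \<Rightarrow> ereal" and \<pi> :: 'a
    and \<rho> :: "'a \<Rightarrow> 'k::field"
    and vb :: "'a alg_closure \<Rightarrow> ereal"
    and \<rho>b :: "'a alg_closure \<Rightarrow> 'k alg_closure"
    and p n :: nat
    and f :: "'a poly"
    and R :: "'a set"
    and t :: "'a proj_point \<times> 'a proj_point \<times> 'a proj_point"
    and s :: "'a set" and r :: 'a
    and \<mu> e :: int
    and F ft :: "'a poly"
    and ft_bar :: "'k poly"
    and c :: 'a and d :: nat
    and \<gamma> :: "'a alg_closure"
  assumes K: "complete_discretely_valued_field v \<pi>"
    and residue_field: "residue_map v \<rho>"
    and p: "CHAR('k) = p"
    and val_ext: "valued_field vb" "\<And>x. vb (to_ac x) = v x"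
    and residue_ext: "residue_map vb \<rho>b" "\<And>x. 0 \<le> v x \<Longrightarrow> \<rho>b (to_ac x) = to_ac (\<rho> x)"
    and n: "2 \<le> n" "\<not> p dvd n"
    and root_of_unity: "\<exists>\<zeta>::'a. \<zeta> ^ n = 1 \<and> (\<forall>j. 0 < j \<and> j < n \<longrightarrow> \<zeta> ^ j \<noteq> 1)"
    and f_integral: "\<And>i. 0 \<le> v (Polynomial.coeff f i)"
    and f_monic: "Polynomial.lead_coeff f = 1"
    and f_disc: "discriminant f \<noteq> 0"
    and f_roots: "root_set (map_poly to_ac f) \<subseteq> range to_ac"
    and genus: "0 < superelliptic_genus n f"
    and R: "R = root_set f"
    and t: "t \<in> triples (branch_points n f)"
    and s: "s = Phi vb R t"
    and r: "r \<in> s"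
    and \<mu>: "\<mu> = int_val (diameter v s)"
    and F: "F = pcompose f [:r, \<pi> powi \<mu>:]"
    and e: "e = int_val (content_val v F)"
    and ft: "ft = smult (\<pi> powi (- e)) F"
    and ft_bar: "ft_bar = map_poly \<rho> ft"
    and c: "c = (\<Prod>\<beta>\<in>R - s. (r - \<beta>) / \<pi> powi int_val (v (r - \<beta>)))"
    and d: "d = Gcd (insert n (card ` children vb R s))"
    and \<gamma>: "\<gamma> ^ d = to_ac c"
  shows "curve_components_over n ft_bar d (residue_subfield vb \<rho>b (adjoin (range to_ac) \<gamma>)) \<and>
    normalization_components_over n ft_bar d (residue_subfield vb \<rho>b (adjoin (range to_ac) \<gamma>))"
proof -
  interpret complete_discretely_valued_field v \<pi> by (rule K)
  interpret residue_map v \<rho> by (rule residue_field)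
  interpret vb: residue_map vb \<rho>b by (rule residue_ext(1))
  have f0: "f \<noteq> 0" using f_monic by auto
  then have finite_R: "finite R"
    by (simp add: R root_set_def poly_roots_finite)
  obtain a b where "a \<in> root_set f" "b \<in> root_set f" and ab_neq: "a \<noteq> b"
    and "Phi vb (root_set f) t = {x \<in> root_set f. v (a - b) \<le> v (x - a)}"
    by (rule Phi_triple[OF valued_field_axioms val_ext(2) t])
  then have ab_R: "a \<in> R" "b \<in> R" and s_ab: "s = {x \<in> R. v (a - b) \<le> v (x - a)}"
    by (simp_all only: R s)
  have ab_s: "a \<in> s" "b \<in> s" using ab_R by (simp_all add: s_ab val_diff_commute[of b a])
  \<comment> \<open>No two points of the disc about \<open>a\<close> through \<open>b\<close> are
    further apart than \<open>a\<close> and \<open>b\<close>; so the diameter is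
    \<open>v (a - b)\<close>, and it is attained.\<close>
  have ge: "v (a - b) \<le> v (x - y)" if xy: "x \<in> s" "y \<in> s" for x y
  proof (rule val_trans_le)
    show "v (a - b) \<le> v (x - a)" using xy(1) by (simp add: s_ab)
    show "v (a - b) \<le> v (a - y)" using xy(2) unfolding val_diff_commute[of a y] by (simp add: s_ab)
  qed
  have "diameter v s = v (a - b)"
    using finite_R by (intro diameter_eqI ab_s ge) (simp_all add: s_ab)
  then have v_ab: "v (a - b) = ereal (of_int \<mu>)"
    using val_int_val[of "a - b"] ab_neq by (simp add: \<mu>)
  interpret cluster v \<pi> \<rho> R s r \<mu>
  proof
    show "finite R" by (rule finite_R)
    show "r \<in> s" by (rule r)
    show "\<exists>a\<in>s. \<exists>b\<in>s. v (a - b) = ereal (of_int \<mu>)" using ab_s v_ab by auto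
    show "s = {x \<in> R. ereal (of_int \<mu>) \<le> v (x - r)}"
    proof (intro equalityI subsetI)
      fix x assume "x \<in> s"
      then show "x \<in> {x \<in> R. ereal (of_int \<mu>) \<le> v (x - r)}"
        using ge[OF _ r, of x] by (simp add: s_ab v_ab)
    next
      fix x assume "x \<in> {x \<in> R. ereal (of_int \<mu>) \<le> v (x - r)}"
      then have "x \<in> R" "v (a - b) \<le> v (x - r)" by (simp_all add: v_ab)
      then show "x \<in> s"
        using val_trans_le[OF _ ge[OF r ab_s(1)], of x] by (simp add: s_ab)
    qed
  qed
  have children: "children vb R s = fiber ` coord ` s"
    using children_eq[OF val_ext] .
  have f: "f = (\<Prod>\<beta>\<in>R. [:- \<beta>, 1:])"
    unfolding R using f_monic f_disc f_roots by (rule separable_split)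
  have c_eq: "c = outer_unit" by (simp add: c outer_unit_def)
  have vc: "v c = 0" and red_c: "\<rho> c \<noteq> 0"
    by (simp_all add: c_eq val_outer_unit red_outer_unit)
  have ft_bar_eq: "ft_bar = smult (\<rho> c) (\<Prod>b\<in>coord ` s. [:- b, 1:] ^ card (fiber b))"
    using reduced_equation[OF f] by (simp add: ft_bar ft e F c_eq)
  have d_n: "d dvd n" and d_card: "\<And>b. b \<in> coord ` s \<Longrightarrow> d dvd card (fiber b)"
    unfolding d children by (rule Gcd_dvd, blast)+
  define m where "m = n div d"
  have n_eq: "n = d * m" using d_n by (simp add: m_def)
  have d_pos: "d > 0" and m_pos: "m > 0" using n(1) n_eq by (auto intro!: gr0I)
  \<comment> \<open>The gcd \<open>d\<close> divides the size of every child, so the product of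
    linear powers is a \<open>d\<close>-th power already over \<open>k\<close>.\<close>
  define h where "h = (\<Prod>b\<in>coord ` s. [:- b, 1:] ^ (card (fiber b) div d))"
  have h_pow: "h ^ d = (\<Prod>b\<in>coord ` s. [:- b, 1:] ^ card (fiber b))"
    unfolding h_def prod_power_distrib
    using d_card by (intro prod.cong) (simp_all flip: power_mult)
  have h_nz: "h \<noteq> 0" using finite_s by (simp add: h_def)
  have hb: "map_poly to_ac h = (\<Prod>b\<in>to_ac ` coord ` s. [:- b, 1:] ^ (card (fiber (of_ac b)) div d))"
    unfolding h_def
    by (subst prod.reindex) (simp_all add: inj_on_def map_to_ac_hom.hom_prod map_to_ac_hom.hom_power
        to_ac_hom.map_poly_pCons_hom)
  \<comment> \<open>Multiplying by \<open>d\<close>, the assumption says that \<open>n\<close>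
    divides \<open>j\<close> times the size of every child; trivially it also divides
    \<open>j n\<close>. Hence \<open>n\<close> divides \<open>j d\<close>, and cancelling
    \<open>d\<close> gives the claim.\<close>
  have orders: "m dvd j" if j: "\<And>b. m dvd j * Polynomial.order b (map_poly to_ac h)" for j
  proof -
    have "n dvd j * card (fiber b)" if b: "b \<in> coord ` s" for b
    proof -
      have "Polynomial.order (to_ac b) (map_poly to_ac h) = card (fiber b) div d"
        using finite_s b unfolding hb by (subst order_prod_linear_powers) auto
      then have "d * m dvd d * (j * (card (fiber b) div d))"
        using j[of "to_ac b"] by simp
      moreover have "d * (j * (card (fiber b) div d)) = j * card (fiber b)"
        using d_card[OF b] by (metis dvd_mult_div_cancel mult.left_commute)
      ultimately show ?thesis by (simp add: n_eq)
    qed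
    then have "n dvd Gcd ((*) j ` insert n (card ` children vb R s))"
      by (intro Gcd_greatest) (auto simp: children)
    then have "d * m dvd d * j"
      unfolding Gcd_mult d[symmetric] by (simp add: n_eq mult.commute)
    then show ?thesis using d_pos by simp
  qed
  obtain \<zeta> :: 'a where \<zeta>: "\<zeta> ^ n = 1" "\<And>j. 0 < j \<Longrightarrow> j < n \<Longrightarrow> \<zeta> ^ j \<noteq> 1"
    using root_of_unity by auto
  have "\<not> CHAR('k) dvd n" using n(2) p by simp
  note red_\<zeta> = red_root_of_unity_inj[OF this \<zeta>]
  \<comment> \<open>The reduction of \<open>\<zeta>\<close> has exact order \<open>n = d m\<close>,
    so its \<open>m\<close>-th power has exact order \<open>d\<close>.\<close>
  define z where "z = to_ac (\<rho> \<zeta> ^ m)"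
  have z_pow: "z ^ j = to_ac (\<rho> \<zeta> ^ (m * j))" for j
    by (simp add: z_def power_mult)
  have z_d: "z ^ d = 1"
    using red_power[of \<zeta> n] red_\<zeta>(1) \<zeta>(1) by (simp add: z_pow red_one n_eq mult.commute flip: to_ac_power)
  have z_inj: "inj_on (\<lambda>j. z ^ j) {..<d}"
  proof (rule inj_onI)
    fix i j assume ij: "i \<in> {..<d}" "j \<in> {..<d}" "z ^ i = z ^ j"
    then have "\<rho> \<zeta> ^ (m * i) = \<rho> \<zeta> ^ (m * j)" by (simp only: z_pow to_ac_eq_iff)
    moreover have "m * i \<in> {..<n}" "m * j \<in> {..<n}" using ij m_pos by (simp_all add: n_eq)
    ultimately have "m * i = m * j" using red_\<zeta>(2) by (auto dest: inj_onD)
    then show "i = j" using m_pos by simp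
  qed
  have v\<gamma>: "vb \<gamma> = 0"
    using d_pos by (intro vb.val_power_eq_zero[of \<gamma> d]) (simp_all add: \<gamma> val_ext(2) vc)
  have red_\<gamma>: "\<rho>b \<gamma> ^ d = to_ac (\<rho> c)"
    using vb.red_power[of \<gamma> d] residue_ext(2)[of c] by (simp add: v\<gamma> \<gamma> vc)
  \<comment> \<open>This constant is the reduction of \<open>- \<zeta>^(m j) \<gamma>\<close>, an
    element of \<open>K(\<gamma>)\<close> of valuation 0.\<close>
  have M: "- (z ^ j * \<rho>b \<gamma>) \<in> residue_subfield vb \<rho>b (adjoin (range to_ac) \<gamma>)" for j
  proof -
    let ?x = "to_ac (- (\<zeta> ^ (m * j)))"
    have "?x \<otimes>\<^bsub>ring_of_type_algebra\<^esub> \<gamma> \<in> adjoin (range to_ac) \<gamma>"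
      unfolding adjoin_def by (intro generate_field.eng_mult generate_field.incl) blast+
    then have mem: "?x * \<gamma> \<in> adjoin (range to_ac) \<gamma>" by simp
    have vx: "0 \<le> v (- (\<zeta> ^ (m * j)))" using red_\<zeta>(1) by (simp add: val_power_nonneg)
    then have vbx: "0 \<le> vb ?x" using val_ext(2) by metis
    have "\<rho>b (?x * \<gamma>) = \<rho>b ?x * \<rho>b \<gamma>" 
      using vb.red_mult[OF vbx, of \<gamma>] by (simp only: v\<gamma> order_refl)
    also have "\<rho>b ?x = to_ac (- (\<rho> \<zeta> ^ (m * j)))"
      using residue_ext(2)[OF vx] red_\<zeta>(1) by (simp only: red_uminus red_power val_power_nonneg order_refl)
    also have "\<dots> = - (z ^ j)" by (simp add: z_pow)
    finally have "- (z ^ j * \<rho>b \<gamma>) = \<rho>b (?x * \<gamma>)" by simp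
    moreover have "0 \<le> vb (?x * \<gamma>)" using vbx by (simp add: vb.val_mult v\<gamma>)
    ultimately show ?thesis unfolding residue_subfield_def using mem by blast
  qed
  interpret curve: split_superelliptic n d m ft_bar h "\<rho> c" "\<rho>b \<gamma>" z
    "residue_subfield vb \<rho>b (adjoin (range to_ac) \<gamma>)"
  proof
    show "ft_bar = smult (\<rho> c) (h ^ d)" by (simp only: ft_bar_eq h_pow)
  qed (fact n_eq d_pos m_pos h_nz red_c red_\<gamma> z_d z_inj orders | rule M)+
  show ?thesis
    using curve.curve_components curve.normalization_components by blast
qed

end
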